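(* Let $X$ be a totally $\sigma$-finite measure space, let $(U^t)_{t\in\mathbb{R}}$ be a one-parameter group of measure-preserving transformations of $X$ such that for every measurable function $f$ on $X$ the function $(t,x)\mapsto f(U^tx)$ is measurable on the product $\mathbb{R}\times X$, and let $(T_n)$ be a sequence of admissible operators (as defined in the context), with associated maximal operators $S=\sup_n|T_n|$ and $S^\sharp=\sup_n|T_n^\sharp|$. Let $1\leq r\leq\infty$ and $1\leq p<\infty$. (i) Suppose that there exists a constant $C_1>0$ such that $$\left(\int_{\mathbb{R}}\|Sf(t)\|_{l^r}^p\,dt\right)^{1/p}\leq C_1\left(\int_{\mathbb{R}}\|f(t)\|_{l^r}^p\,dt\right)^{1/p}$$ for every sequence $f=(f_1,f_2,f_3,\dots)$ of locally integrable functions on $\mathbb{R}$. Then $$\left(\int_X\|S^\sharp f(x)\|_{l^r}^p\,dx\right)^{1/p}\leq C_1\left(\int_X\|f(x)\|_{l^r}^p\,dx\right)^{1/p}$$ for every sequence $f=(f_1,f_2,f_3,\dots)$ of functions on $X$, each $f_j$ being the sum of a bounded measurable function and an integrable function. (ii) Suppose that there exists a constant $C_2>0$ such that for all $\lambda>0$ $$\left|\left\{t\in\mathbb{R}:\|Sf(t)\|_{l^r}>\lambda\right\}\right|\leq\frac{C_2^p}{\lambda^p}\int_{\mathbb{R}}\|f(t)\|_{l^r}^p\,dt$$ for every sequence $f=(f_1,f_2,f_3,\dots)$ of locally integrable functions on $\mathbb{R}$. Then for all $\lambda>0$ $$\left|\left\{x\in X:\|S^\sharp f(x)\|_{l^r}>\lambda\right\}\right|\leq\frac{C_2^p}{\lambda^p}\int_X\|f(x)\|_{l^r}^p\,dx$$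 for every sequence $f=(f_1,f_2,f_3,\dots)$ of functions on $X$, each $f_j$ being the sum of a bounded measurable function and an integrable function.
   Context: Here $dx$ denotes integration with respect to the given measure on $X$, and $|E|$ denotes the measure of a set $E$ (Lebesgue measure if $E\subseteq\mathbb{R}$, the given measure if $E\subseteq X$). Admissible operators: an operator $T$ defined on the space of locally integrable functions on $\mathbb{R}$ is called admissible here if (1) its values are continuous functions on $\mathbb{R}$; (2) $T$ is sublinear, i.e. $|T(f+g)|\leq|Tf|+|Tg|$ and $|T(cf)|=|c||Tf|$ for scalars $c$; (3) $T$ commutes with translations of $\mathbb{R}$; (4) $T$ is semilocal: there exists $\epsilon>0$ such that for every $f$ the support of $Tf$ is contained in the $\epsilon$-neighborhood of the support of $f$. Transferred operator: let $T$ be admissible and let $f$ be a function on $X$ that is the sum of a bounded measurable function and an integrable function. Put $F(t,x)=f(U^tx)$. For almost all $x$, $F(\cdot,x)$ is locally integrable in $t$, so $G(t,x)=T(F(\cdot,x))(t)$ is a well-defined continuous function of $t$ for almost all $x$. Define $T^\sharp f(x)=G(0,x)$. Maximal operators: for a sequence $(T_n)$ of admissible operators (the number $\epsilon$ in (4) may depend on $n$), set $Sf=\sup_n|T_nf|$ for scalar functions $f$ on $\mathbb{R}$ and $S^\sharp f=\sup_n|T_n^\sharp f|$ for scalar functions $f$ on $X$. Vector-valued notation: operators act componentwise on sequences $f=(f_1,f_2,f_3,\dots)$, i.e. $Sf=(Sf_1,Sf_2,Sf_3,\dots)$ and $S^\sharp f=(S^\sharp f_1,S^\sharp f_2,S^\sharp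 f_3,\dots)$. For a sequence $h=(h_1,h_2,\dots)$ of functions, $\|h(x)\|_{l^r}=\left(\sum_{j=1}^\infty|h_j(x)|^r\right)^{1/r}$ if $1\leq r<\infty$, and $\|h(x)\|_{l^\infty}=\sup_j|h_j(x)|$; these values may be $+\infty$. *)

theory Defs
  imports "HOL-Analysis.Analysis"
begin

(* The scalar field is a type 'k of sort {real_normed_field, euclidean_space}, which covers both
   the real and the complex numbers. *)

definition locally_integrable :: "(real \<Rightarrow> 'k::euclidean_space) \<Rightarrow> bool" where
  "locally_integrable f \<longleftrightarrow> (\<forall>K. compact K \<longrightarrow> set_integrable lebesgue K f)"

(* Support of a locally integrable function: the complement of the largest open set on which it
   vanishes almost everywhere. For continuous functions this is the closure of {t. f t \<noteq> 0}. *)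
definition lsupport :: "(real \<Rightarrow> 'k::euclidean_space) \<Rightarrow> real set" where
  "lsupport f = - \<Union>{V. open V \<and> (AE t in lebesgue. t \<in> V \<longrightarrow> f t = 0)}"

(* Operators act on representatives rather than on almost-everywhere classes. An operator on classes
   gives an operator on representatives with the properties below. Conversely, these properties imply
   that \<bar>T f\<bar> depends only on the class of f: if f = g almost everywhere then f - g has empty support,
   so T (f - g) = 0, and \<bar>T f\<bar> = \<bar>T g\<bar> by sublinearity.
   The values of T at functions that are not locally integrable are irrelevant. *)
definition admissible ::
  "((real \<Rightarrow> 'k::{real_normed_field, euclidean_space}) \<Rightarrow> real \<Rightarrow> 'k) \<Rightarrow> bool" where
  "admissible T \<longleftrightarrow>
     (\<forall>f. locally_integrable f \<longrightarrow> continuous_on UNIV (T f)) \<and>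
     (\<forall>f g t. locally_integrable f \<longrightarrow> locally_integrable g \<longrightarrow>
        norm (T (\<lambda>s. f s + g s) t) \<le> norm (T f t) + norm (T g t)) \<and>
     (\<forall>f c t. locally_integrable f \<longrightarrow> norm (T (\<lambda>s. c * f s) t) = norm c * norm (T f t)) \<and>
     (\<forall>f a t. locally_integrable f \<longrightarrow> T (\<lambda>s. f (s + a)) t = T f (t + a)) \<and>
     (\<exists>\<epsilon>>0. \<forall>f. locally_integrable f \<longrightarrow> lsupport (T f) \<subseteq> (\<Union>s\<in>lsupport f. ball s \<epsilon>))"

definition measure_preserving_flow :: "'a measure \<Rightarrow> (real \<Rightarrow> 'a \<Rightarrow> 'a) \<Rightarrow> bool" where
  "measure_preserving_flow M U \<longleftrightarrow>
     (\<forall>t. U t \<in> measurable M M) \<and>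
     (\<forall>t. \<forall>A\<in>sets M. emeasure M (U t -` A \<inter> space M) = emeasure M A) \<and>
     (\<forall>x\<in>space M. U 0 x = x) \<and>
     (\<forall>s t. \<forall>x\<in>space M. U (s + t) x = U s (U t x))"

definition bounded_plus_integrable :: "'a measure \<Rightarrow> ('a \<Rightarrow> 'k::euclidean_space) \<Rightarrow> bool" where
  "bounded_plus_integrable M f \<longleftrightarrow>
     (\<exists>g h. g \<in> borel_measurable M \<and> bounded (g ` space M) \<and> integrable M h \<and>
            (\<forall>x\<in>space M. f x = g x + h x))"

(* Meaningful where the orbit function is locally integrable, which is the case for almost every x
   when f is the sum of a bounded measurable and an integrable function. *)
definition transferred ::
  "(real \<Rightarrow> 'a \<Rightarrow> 'a) \<Rightarrow> ((real \<Rightarrow> 'k) \<Rightarrow> real \<Rightarrow> 'k) \<Rightarrow> ('a \<Rightarrow> 'k) \<Rightarrow> 'a \<Rightarrow> 'k" where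
  "transferred U T f x = T (\<lambda>t. f (U t x)) 0"

definition maximal ::
  "(nat \<Rightarrow> ('b \<Rightarrow> 'k) \<Rightarrow> 'b \<Rightarrow> 'k::real_normed_vector) \<Rightarrow> ('b \<Rightarrow> 'k) \<Rightarrow> 'b \<Rightarrow> ennreal" where
  "maximal T f x = (SUP n. ennreal (norm (T n f x)))"

(* Power with exponent a > 0 on the extended nonnegative reals. *)
definition epow :: "ennreal \<Rightarrow> real \<Rightarrow> ennreal" where
  "epow x a = (if x = \<infinity> then \<infinity> else ennreal (enn2real x powr a))"

definition lr_norm :: "ennreal \<Rightarrow> (nat \<Rightarrow> ennreal) \<Rightarrow> ennreal" where
  "lr_norm r h =
     (if r = \<infinity> then (SUP j. h j) else epow (\<Sum>j. epow (h j) (enn2real r)) (1 / enn2real r))"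

end

theory Submission
  imports Defs
begin

text \<open>
  The proof is Calderon's transference. Along the orbit of a point \<open>x\<close> a function \<open>f\<close> on the space becomes the
  function \<open>F t = f (U t x)\<close> on the line, and because \<open>T\<close> commutes with translations, \<open>T\<^sup>\<sharp> f\<close> at \<open>U t x\<close> is \<open>T F\<close> at \<open>t\<close>
  (\<open>transferred_along_orbit\<close>). The inequality on the line cannot be applied to \<open>F\<close> itself, whose norm over
  the whole line is usually infinite. But the first \<open>N\<close> operators are semilocal with a common \<open>\<epsilon>\<close>, so on \<open>[-A, A]\<close>
  their moduli do not change if \<open>F\<close> is cut off outside \<open>[-(A + \<epsilon>), A + \<epsilon>]\<close>. The line inequality for the cut-off
  function, integrated over \<open>x\<close>, gives by invariance of the measure (\<open>orbit_integral\<close>) the inequality on the space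
  with the additional factor \<open>(A + \<epsilon>) / A\<close>. This factor tends to \<open>1\<close> as \<open>A \<rightarrow> \<infinity>\<close>, and monotone convergence as \<open>N \<rightarrow> \<infinity>\<close>
  yields the full maximal operator. The strong and the weak inequality are treated at once as inequalities for
  the integral of \<open>\<psi>\<close> of the maximal function (\<open>transferred_inequality\<close>).

  The delicate point is that \<open>T\<^sup>\<sharp> f\<close> is measurable at all, since admissible operators are not assumed to be
  continuous for any topology on functions. Sublinearity gives \<open>\<bar>\<bar>T f\<bar> - \<bar>T g\<bar>\<bar> \<le> \<bar>T (f - g)\<bar>\<close>, so either of the assumed
  inequalities, which both contain a weak type bound for each single operator, makes \<open>\<bar>T f\<bar>\<close> depend continuously
  on \<open>f\<close> in \<open>L\<^sup>p\<close>, in the sense of convergence in measure. Measurability needs to be shown only if the right-hand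
  side is finite, and then almost every orbit function is locally in \<open>L\<^sup>p\<close>. A measurable choice of approximations
  from a countable dense set of step functions expresses \<open>\<bar>T F t\<bar>\<close>, for almost every \<open>t\<close>, as a limit of jointly
  measurable functions, and since \<open>T F\<close> is continuous, averages over short intervals around \<open>0\<close> recover the
  value at time \<open>0\<close>, which is \<open>\<bar>T\<^sup>\<sharp> f x\<bar>\<close> (\<open>transferred_measurable\<close>).
\<close>

section \<open>Powers and sequence norms of extended nonnegative functions\<close>

lemma epow_zero [simp]: "0 < a \<Longrightarrow> epow 0 a = 0"
  by (simp add: epow_def)

lemma epow_top [simp]: "epow \<infinity> a = \<infinity>" "epow top a = top"
  by (simp_all add: epow_def)

lemma epow_ennreal: "0 \<le> x \<Longrightarrow> epow (ennreal x) a = ennreal (x powr a)"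
  by (simp add: epow_def)

lemma epow_epow:
  assumes "0 < a" "0 < b" shows "epow (epow x a) b = epow x (a * b)"
  by (cases x) (use assms in \<open>auto simp: epow_ennreal powr_powr\<close>)

lemma epow_one [simp]: "epow x 1 = x"
  by (cases x) (auto simp: epow_ennreal)

lemma epow_mono:
  assumes "0 < a" "x \<le> y" shows "epow x a \<le> epow y a"
proof (cases y)
  case (real c)
  then obtain d where "x = ennreal d" "0 \<le> d" "d \<le> c"
    using assms by (cases x) (auto simp: top_unique)
  with real assms show ?thesis
    by (auto simp: epow_ennreal intro!: ennreal_leI powr_mono2)
qed simp

text \<open>For \<open>a > 0\<close> the power is an order isomorphism with inverse the power \<open>1 / a\<close>; this Galois
  connection makes it commute with all suprema.\<close>

lemma epow_le_iff:
  assumes "0 < a" shows "epow x a \<le> y \<longleftrightarrow> x \<le> epow y (1 / a)"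
proof
  assume "epow x a \<le> y"
  then have "epow (epow x a) (1/a) \<le> epow y (1/a)"
    using assms by (intro epow_mono) auto
  then show "x \<le> epow y (1 / a)" using assms by (simp add: epow_epow)
next
  assume "x \<le> epow y (1 / a)"
  then have "epow x a \<le> epow (epow y (1/a)) a" using assms by (intro epow_mono)
  then show "epow x a \<le> y" using assms by (simp add: epow_epow)
qed

lemma epow_SUP:
  assumes "0 < a" shows "epow (SUP i\<in>I. u i) a = (SUP i\<in>I. epow (u i) a)"
proof (rule antisym)
  show "epow (SUP i\<in>I. u i) a \<le> (SUP i\<in>I. epow (u i) a)"
    unfolding epow_le_iff[OF assms]
    by (intro SUP_least) (simp only: epow_le_iff[OF assms, symmetric], rule SUP_upper)
  show "(SUP i\<in>I. epow (u i) a) \<le> epow (SUP i\<in>I. u i) a"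
    using assms by (auto intro!: SUP_least epow_mono SUP_upper)
qed

lemma epow_mult:
  assumes "0 < a" "0 \<le> c"
  shows "epow (ennreal c * x) a = ennreal (c powr a) * epow x a"
proof (cases x)
  case (real d)
  with assms show ?thesis
    by (simp add: epow_ennreal powr_mult ennreal_mult[symmetric])
next
  case top
  with assms show ?thesis by (cases "c = 0") (auto simp: ennreal_mult_top)
qed

lemma borel_measurable_epow [measurable (raw)]:
  assumes [measurable]: "f \<in> borel_measurable M"
  shows "(\<lambda>x. epow (f x) a) \<in> borel_measurable M"
  unfolding epow_def by measurable

lemma lr_norm_cases:
  assumes "1 \<le> r"
  obtains "r = \<infinity>" "\<And>h. lr_norm r h = (SUP j. h j)"
  | q where "0 < q" "\<And>h. lr_norm r h = epow (\<Sum>j. epow (h j) q) (1 / q)"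
proof (cases "r = \<infinity>")
  case True
  then show ?thesis by (intro that(1)) (auto simp: lr_norm_def)
next
  case False
  then have "0 < enn2real r" using assms
    by (cases r) (auto simp: ennreal_1[symmetric] simp del: ennreal_1)
  then show ?thesis by (rule that(2)) (use False in \<open>auto simp: lr_norm_def\<close>)
qed

lemma lr_norm_mono:
  assumes "1 \<le> r" "\<And>j. h j \<le> k j" shows "lr_norm r h \<le> lr_norm r k"
  using assms(1)
proof (cases rule: lr_norm_cases)
  case 1
  then show ?thesis using assms(2) by (auto intro!: SUP_mono)
next
  case (2 q)
  then show ?thesis using assms(2) by (auto intro!: epow_mono suminf_le)
qed

lemma component_le_lr_norm:
  assumes "1 \<le> r" shows "h j \<le> lr_norm r h"
  using assms
proof (cases rule: lr_norm_cases)
  case 1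
  then show ?thesis by (simp add: SUP_upper)
next
  case (2 q)
  have "epow (h j) q = (\<Sum>i. if i = j then epow (h j) q else 0)"
    by (subst suminf_finite[of "{j}"]) auto
  also have "\<dots> \<le> (\<Sum>i. epow (h i) q)"
    by (intro suminf_le) auto
  finally show ?thesis using 2 by (simp add: epow_le_iff[symmetric])
qed

lemma lr_norm_single:
  assumes "1 \<le> r" shows "lr_norm r (\<lambda>j. if j = 0 then a else 0) = a"
  using assms
proof (cases rule: lr_norm_cases)
  case 1
  have "(SUP j::nat. if j = 0 then a else 0) = a"
    by (intro antisym SUP_least) (auto intro: SUP_upper2[of 0])
  with 1 show ?thesis by simp
next
  case (2 q)
  have "(\<Sum>j::nat. epow (if j = 0 then a else 0) q) = epow a q"
    using 2 by (subst suminf_finite[of "{0}"]) auto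
  with 2 show ?thesis by (simp add: epow_epow)
qed

lemma lr_norm_zero: "1 \<le> r \<Longrightarrow> lr_norm r (\<lambda>j. 0) = 0"
  using lr_norm_single[of r 0] by simp

lemma borel_measurable_lr_norm [measurable (raw)]:
  assumes [measurable]: "\<And>j. (\<lambda>x. h x j) \<in> borel_measurable M"
  shows "(\<lambda>x. lr_norm r (\<lambda>j. h x j)) \<in> borel_measurable M"
proof (cases "r = \<infinity>")
  case True
  then show ?thesis unfolding lr_norm_def by simp
next
  case False
  then show ?thesis unfolding lr_norm_def by simp
qed

text \<open>Monotone convergence for the counting measure on the index \<open>j\<close>: it lets a supremum over finitely
  many operators grow to the full maximal operator inside the sequence norm.\<close>

lemma lr_norm_SUP:
  fixes h :: "nat \<Rightarrow> nat \<Rightarrow> ennreal"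
  assumes r: "1 \<le> r" and h: "\<And>j. incseq (\<lambda>N. h N j)"
  shows "lr_norm r (\<lambda>j. SUP N. h N j) = (SUP N. lr_norm r (h N))"
  using r
proof (cases rule: lr_norm_cases)
  case 1
  then show ?thesis by (simp only: 1) (rule SUP_commute)
next
  case (2 q)
  have "(\<Sum>j. SUP N. epow (h N j) q) = (SUP N. \<Sum>j. epow (h N j) q)"
    using h 2 by (intro ennreal_suminf_SUP_eq) (auto simp: incseq_def intro!: epow_mono)
  with 2 show ?thesis by (simp add: epow_SUP)
qed

section \<open>Locally integrable functions and admissible operators\<close>

lemma locally_integrable_measurable:
  assumes "locally_integrable f" shows "f \<in> borel_measurable lebesgue"
proof (rule borel_measurable_LIMSEQ_metric)
  fix n :: nat
  show "(\<lambda>t. indicator {- real n..real n} t *\<^sub>R f t) \<in> borel_measurable lebesgue"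
    using assms[unfolded locally_integrable_def, rule_format, of "{- real n..real n}"]
    by (auto simp: set_integrable_def)
next
  fix t :: real
  obtain N where N: "\<bar>t\<bar> \<le> real N" using real_arch_simple by blast
  have "indicator {- real n..real n} t *\<^sub>R f t = f t" if "N \<le> n" for n
    using N that by (auto simp: indicator_def)
  then show "(\<lambda>n. indicator {- real n..real n} t *\<^sub>R f t) \<longlonglongrightarrow> f t"
    by (intro tendsto_eventually) (auto simp: eventually_sequentially)
qed

lemma locally_integrable_iff:
  "locally_integrable f \<longleftrightarrow> f \<in> borel_measurable lebesgue \<and>
     (\<forall>n::nat. (\<integral>\<^sup>+t. indicator {- real n..real n} t * ennreal (norm (f t)) \<partial>lebesgue) < \<infinity>)"
proof (intro iffI conjI allI)
  assume f: "locally_integrable f"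
  then show m: "f \<in> borel_measurable lebesgue" by (rule locally_integrable_measurable)
  fix n :: nat
  have "integrable lebesgue (\<lambda>t. indicator {- real n..real n} t *\<^sub>R f t)"
    using f[unfolded locally_integrable_def, rule_format, of "{- real n..real n}"]
    by (auto simp: set_integrable_def)
  then have "(\<integral>\<^sup>+t. ennreal (norm (indicator {- real n..real n} t *\<^sub>R f t)) \<partial>lebesgue) < \<infinity>"
    by (simp add: integrable_iff_bounded)
  moreover have "ennreal (norm (indicator {- real n..real n} t *\<^sub>R f t))
      = indicator {- real n..real n} t * ennreal (norm (f t))" for t
    by (auto simp: indicator_def)
  ultimately show "(\<integral>\<^sup>+t. indicator {- real n..real n} t * ennreal (norm (f t)) \<partial>lebesgue) < \<infinity>"
    by simp
next
  assume *: "f \<in> borel_measurable lebesgue \<and>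
     (\<forall>n::nat. (\<integral>\<^sup>+t. indicator {- real n..real n} t * ennreal (norm (f t)) \<partial>lebesgue) < \<infinity>)"
  then have [measurable]: "f \<in> borel_measurable lebesgue" by auto
  show "locally_integrable f"
    unfolding locally_integrable_def set_integrable_def
  proof (intro allI impI)
    fix K :: "real set" assume "compact K"
    then have K[measurable]: "K \<in> sets lebesgue"
      by (simp add: borel_closed compact_imp_closed)
    obtain b where b: "\<And>t. t \<in> K \<Longrightarrow> \<bar>t\<bar> \<le> b"
      using compact_imp_bounded[OF \<open>compact K\<close>] by (auto simp: bounded_iff)
    obtain n where n: "b \<le> real n" using real_arch_simple by blast
    have "(\<integral>\<^sup>+t. ennreal (norm (indicator K t *\<^sub>R f t)) \<partial>lebesgue)
        \<le> (\<integral>\<^sup>+t. indicator {- real n..real n} t * ennreal (norm (f t)) \<partial>lebesgue)"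
      by (intro nn_integral_mono) (use b n in \<open>fastforce simp: indicator_def split: if_splits\<close>)
    also have "\<dots> < \<infinity>" using * by auto
    finally show "integrable lebesgue (\<lambda>t. indicator K t *\<^sub>R f t)"
      by (intro integrableI_bounded) auto
  qed
qed

lemma locally_integrable_diff:
  "locally_integrable f \<Longrightarrow> locally_integrable g \<Longrightarrow> locally_integrable (\<lambda>t. f t - g t)"
  by (auto simp: locally_integrable_def)

lemma locally_integrable_restrict:
  assumes "locally_integrable f" "S \<in> sets lebesgue"
  shows "locally_integrable (\<lambda>t. indicator S t *\<^sub>R f t)"
  unfolding locally_integrable_iff
proof (intro conjI allI)
  note [measurable] = locally_integrable_measurable[OF assms(1)] assms(2)
  show "(\<lambda>t. indicator S t *\<^sub>R f t) \<in> borel_measurable lebesgue" by measurable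
  fix n :: nat
  have "(\<integral>\<^sup>+t. indicator {- real n..real n} t * ennreal (norm (indicator S t *\<^sub>R f t)) \<partial>lebesgue)
      \<le> (\<integral>\<^sup>+t. indicator {- real n..real n} t * ennreal (norm (f t)) \<partial>lebesgue)"
    by (intro nn_integral_mono) (auto simp: indicator_def)
  also have "\<dots> < \<infinity>" using assms(1) by (auto simp: locally_integrable_iff)
  finally show "(\<integral>\<^sup>+t. indicator {- real n..real n} t * ennreal (norm (indicator S t *\<^sub>R f t)) \<partial>lebesgue) < \<infinity>" .
qed

lemma locally_integrable_bounded:
  assumes "f \<in> borel_measurable lebesgue" "\<And>t. norm (f t) \<le> B"
  shows "locally_integrable f"
  unfolding locally_integrable_iff
proof (intro conjI allI assms(1))
  fix n :: nat
  have "(\<integral>\<^sup>+t. indicator {- real n..real n} t * ennreal (norm (f t)) \<partial>lebesgue)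
      \<le> (\<integral>\<^sup>+t. ennreal B * indicator {- real n..real n} t \<partial>lebesgue)"
    by (intro nn_integral_mono) (use assms(2) in \<open>auto simp: indicator_def intro: ennreal_leI\<close>)
  also have "\<dots> < \<infinity>"
    by (subst nn_integral_cmult_indicator) (auto simp: ennreal_mult_less_top)
  finally show "(\<integral>\<^sup>+t. indicator {- real n..real n} t * ennreal (norm (f t)) \<partial>lebesgue) < \<infinity>" .
qed

lemma locally_integrable_zero [simp]: "locally_integrable (\<lambda>t. 0)"
  by (rule locally_integrable_bounded[where B=0]) auto

text \<open>This is what turns statements about \<^const>\<open>lsupport\<close>, which only sees functions up to null sets,
  into pointwise statements about the continuous values of an admissible operator.\<close>

lemma continuous_AE_zero_on_open:
  fixes u :: "real \<Rightarrow> 'k::euclidean_space"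
  assumes "continuous_on UNIV u" "open V" "AE t in lebesgue. t \<in> V \<longrightarrow> u t = 0" "t \<in> V"
  shows "u t = 0"
proof (rule ccontr)
  let ?W = "{t \<in> V. u t \<noteq> 0}"
  assume "u t \<noteq> 0"
  then have "?W \<noteq> {}" using assms by auto
  moreover have "?W = V \<inter> u -` (- {0})" by auto
  then have "open ?W"
    using assms by (auto intro!: open_Int open_vimage)
  moreover have "negligible ?W"
  proof -
    have eq: "{t \<in> space lebesgue. \<not> (t \<in> V \<longrightarrow> u t = 0)} = ?W" by auto
    have "?W \<in> sets lebesgue" using \<open>open ?W\<close> by simp
    then have "?W \<in> null_sets lebesgue"
      using AE_iff_null[of lebesgue "\<lambda>t. t \<in> V \<longrightarrow> u t = 0"] assms(3) unfolding eq by simp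
    then show ?thesis by (simp add: negligible_iff_null_sets)
  qed
  ultimately show False using open_not_negligible by blast
qed

text \<open>The form in which the support condition is used: on an interval shrunk by \<open>\<epsilon>\<close> at both ends, the
  modulus of the value depends only on the almost-everywhere class of the argument on the interval.
  No claim is made about the value itself, since a sublinear operator controls only moduli.\<close>

definition semilocal ::
  "((real \<Rightarrow> 'k::euclidean_space) \<Rightarrow> real \<Rightarrow> 'k) \<Rightarrow> real \<Rightarrow> bool" where
  "semilocal T \<epsilon> \<longleftrightarrow> (\<forall>f g a b t. locally_integrable f \<longrightarrow> locally_integrable g \<longrightarrow>
     (AE s in lebesgue. s \<in> {a<..<b} \<longrightarrow> f s = g s) \<longrightarrow> a + \<epsilon> \<le> t \<longrightarrow> t \<le> b - \<epsilon> \<longrightarrow>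
     norm (T f t) = norm (T g t))"

lemma semilocalD:
  assumes "semilocal T \<epsilon>" "locally_integrable f" "locally_integrable g"
    "AE s in lebesgue. s \<in> {a<..<b} \<longrightarrow> f s = g s" "a + \<epsilon> \<le> t" "t \<le> b - \<epsilon>"
  shows "norm (T f t) = norm (T g t)"
  using assms unfolding semilocal_def by blast

lemma semilocal_mono:
  assumes "semilocal T \<epsilon>" "\<epsilon> \<le> \<delta>" shows "semilocal T \<delta>"
  unfolding semilocal_def
proof (intro allI impI)
  fix f g :: "real \<Rightarrow> 'a" and a b t :: real
  assume "locally_integrable f" "locally_integrable g"
    "AE s in lebesgue. s \<in> {a<..<b} \<longrightarrow> f s = g s" "a + \<delta> \<le> t" "t \<le> b - \<delta>"
  with assms show "norm (T f t) = norm (T g t)"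
    by (intro semilocalD[OF assms(1), of f g a b]) auto
qed

context
  fixes T :: "(real \<Rightarrow> 'k::{real_normed_field, euclidean_space}) \<Rightarrow> real \<Rightarrow> 'k"
  assumes T: "admissible T"
begin

lemma admissible_continuous: "locally_integrable f \<Longrightarrow> continuous_on UNIV (T f)"
  using T by (auto simp: admissible_def)

lemma admissible_shift: "locally_integrable f \<Longrightarrow> T (\<lambda>s. f (s + a)) t = T f (t + a)"
  using T by (auto simp: admissible_def)

text \<open>For a sublinear operator \<open>T (f - g)\<close> does not determine \<open>T f - T g\<close>, but it bounds the difference of the
  moduli: subadditivity in both directions, together with \<open>\<bar>T (g - f)\<bar> = \<bar>T (f - g)\<bar>\<close> from homogeneity.\<close>

lemma admissible_diff:
  assumes "locally_integrable f" "locally_integrable g"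
  shows "\<bar>norm (T f t) - norm (T g t)\<bar> \<le> norm (T (\<lambda>s. f s - g s) t)"
proof -
  have add: "norm (T (\<lambda>s. u s + v s) t) \<le> norm (T u t) + norm (T v t)"
    if "locally_integrable u" "locally_integrable v" for u v
    using T that by (auto simp: admissible_def)
  have d: "locally_integrable (\<lambda>s. f s - g s)" "locally_integrable (\<lambda>s. g s - f s)"
    using assms by (auto intro: locally_integrable_diff)
  have "norm (T (\<lambda>s. (- 1) * (f s - g s)) t) = norm (- 1 :: 'k) * norm (T (\<lambda>s. f s - g s) t)"
    using T d(1) unfolding admissible_def by blast
  then have "norm (T (\<lambda>s. g s - f s) t) = norm (T (\<lambda>s. f s - g s) t)" by simp
  with add[OF d(1) assms(2)] add[OF d(2) assms(1)] show ?thesis by simp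
qed

text \<open>If \<open>f\<close> and \<open>g\<close> agree on \<open>(a, b)\<close>, the support of \<open>f - g\<close> avoids that interval, so \<open>T (f - g)\<close> vanishes
  on \<open>[a + \<epsilon>, b - \<epsilon>]\<close>, and the reverse triangle inequality finishes the argument. The end points are
  included because the neighbourhood of the support is a union of open balls.\<close>

lemma admissible_semilocal: "\<exists>\<epsilon>>0. semilocal T \<epsilon>"
proof -
  obtain \<epsilon> where \<epsilon>: "0 < \<epsilon>"
    "\<And>f. locally_integrable f \<Longrightarrow> lsupport (T f) \<subseteq> (\<Union>s\<in>lsupport f. ball s \<epsilon>)"
    using T by (auto simp: admissible_def)
  have "semilocal T \<epsilon>"
    unfolding semilocal_def
  proof (intro allI impI)
    fix f g :: "real \<Rightarrow> 'k" and a b t :: real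
    assume f: "locally_integrable f" and g: "locally_integrable g"
      and eq: "AE s in lebesgue. s \<in> {a<..<b} \<longrightarrow> f s = g s"
      and t: "a + \<epsilon> \<le> t" "t \<le> b - \<epsilon>"
    let ?h = "\<lambda>s. f s - g s"
    have h: "locally_integrable ?h" using f g by (rule locally_integrable_diff)
    have "AE s in lebesgue. s \<in> {a<..<b} \<longrightarrow> ?h s = 0"
      using eq by eventually_elim auto
    then have "{a<..<b} \<subseteq> \<Union>{V. open V \<and> (AE s in lebesgue. s \<in> V \<longrightarrow> ?h s = 0)}"
      by (intro Union_upper) auto
    then have "lsupport ?h \<inter> {a<..<b} = {}"
      unfolding lsupport_def by (simp add: disjoint_eq_subset_Compl)
    then have "t \<notin> (\<Union>s\<in>lsupport ?h. ball s \<epsilon>)"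
      using t by (fastforce simp: dist_real_def)
    then have "t \<notin> lsupport (T ?h)" using \<epsilon>(2)[OF h] by blast
    then obtain V where "open V" "t \<in> V" "AE s in lebesgue. s \<in> V \<longrightarrow> T ?h s = 0"
      unfolding lsupport_def by auto
    then have "T ?h t = 0"
      using continuous_AE_zero_on_open[OF admissible_continuous[OF h]] by blast
    with admissible_diff[OF f g, of t] show "norm (T f t) = norm (T g t)" by simp
  qed
  with \<epsilon>(1) show ?thesis by blast
qed

end

text \<open>Plays the part of the triangle inequality when three approximation errors are measured by the integrals of
  their \<open>p\<close>-th powers.\<close>

lemma powr_sum3_le:
  fixes u v w p :: real
  assumes "0 \<le> u" "0 \<le> v" "0 \<le> w" "0 \<le> p"
  shows "(u + v + w) powr p \<le> 3 powr p * (u powr p + v powr p + w powr p)"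
proof -
  let ?m = "max u (max v w)"
  have "(u + v + w) powr p \<le> (3 * ?m) powr p"
    using assms by (intro powr_mono2) auto
  also have "\<dots> = 3 powr p * ?m powr p" using assms by (simp add: powr_mult)
  also have "?m powr p \<le> u powr p + v powr p + w powr p"
    by (auto simp: max_def)
  finally show ?thesis by simp
qed

section \<open>A countable dense set of step functions\<close>

text \<open>Separability of \<open>L\<^sup>p[-L, L]\<close>, with a dense sequence of representatives. The members are step functions on
  grids of mesh \<open>1 / m\<close> whose values come from a countable dense set of scalars, encoded by \<open>m\<close> and the
  list of values. A function \<open>f\<close> is approximated through its truncations, then by continuous functions,
  then by step functions.\<close>

lemma countable_dense_step_functions:
  fixes p L :: real
  assumes p: "1 \<le> p" and L: "0 < L"
  obtains g :: "nat \<Rightarrow> real \<Rightarrow> 'k::{real_normed_field, euclidean_space}"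
  where "\<And>k. g k \<in> borel_measurable borel" "\<And>k. locally_integrable (g k)"
    "\<And>f e. \<lbrakk>f \<in> borel_measurable borel; 0 < e;
       (\<integral>\<^sup>+t. indicator {-L..L} t * ennreal (norm (f t) powr p) \<partial>lborel) < \<infinity>\<rbrakk> \<Longrightarrow>
       \<exists>k. (\<integral>\<^sup>+t. indicator {-L..L} t * ennreal (norm (f t - g k t) powr p) \<partial>lborel) < ennreal e"
proof -
  obtain D :: "'k set" where D: "countable D" "\<forall>X. open X \<longrightarrow> X \<noteq> {} \<longrightarrow> (\<exists>d\<in>D. d \<in> X)"
    using countable_dense_exists[where 'a='k] by auto
  define step :: "nat \<times> 'k list \<Rightarrow> real \<Rightarrow> 'k" where
    "step = (\<lambda>(m, qs) t. let i = nat \<lfloor>real m * (t + L)\<rfloor> in if i < length qs then qs ! i else 0)"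
  have step_meas: "step mq \<in> borel_measurable borel" for mq
  proof -
    obtain m qs where mq: "mq = (m, qs)" by force
    have "(\<lambda>t. (\<lambda>i. if nat i < length qs then qs ! nat i else 0) \<lfloor>real m * (t + L)\<rfloor>) \<in> borel_measurable borel"
      by (rule measurable_compose[where N="count_space UNIV"]) measurable
    then show ?thesis by (simp add: step_def mq Let_def)
  qed
  have step_LI: "locally_integrable (step mq)" for mq
  proof -
    obtain m qs where mq: "mq = (m, qs)" by force
    have "norm (step mq t) \<le> Max (insert 0 (norm ` set qs))" for t
      by (auto simp: step_def mq Let_def intro!: Max_ge)
    then show ?thesis
      using step_meas[of mq] by (intro locally_integrable_bounded) (auto intro: measurable_completion)
  qed
  let ?C = "UNIV \<times> lists D :: (nat \<times> 'k list) set"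
  have C: "countable ?C" "?C \<noteq> {}" using D(1) by auto
  let ?I = "\<lambda>u :: real \<Rightarrow> 'k. \<integral>\<^sup>+t. indicator {-L..L} t * ennreal (norm (u t) powr p) \<partial>lborel"
  show ?thesis
  proof (rule that[of "\<lambda>k. step (from_nat_into ?C k)"])
    fix f :: "real \<Rightarrow> 'k" and e :: real
    assume f[measurable]: "f \<in> borel_measurable borel" and e: "0 < e" and fin: "?I f < \<infinity>"
    \<comment> \<open>Three errors of at most \<open>e'\<close>, combined with the constant \<open>3 powr p\<close>, amount to at most \<open>3 / 4 * e\<close>.\<close>
    define e' where "e' = e / (4 * 3 powr p)"
    have e': "0 < e'" using e by (simp add: e'_def)
    define fN where "fN = (\<lambda>N::nat. \<lambda>t. if norm (f t) \<le> real N then f t else 0)"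
    have fN_meas[measurable]: "fN N \<in> borel_measurable borel" for N
      unfolding fN_def by measurable
    \<comment> \<open>Truncation: dominated by \<open>\<bar>f\<bar>\<^sup>p\<close>. Only a bounded function can be handled by the next step, where
      convergence almost everywhere is turned into convergence of the integrals.\<close>
    have "(\<lambda>N. ?I (\<lambda>t. f t - fN N t)) \<longlonglongrightarrow> (\<integral>\<^sup>+t. 0 \<partial>(lborel :: real measure))"
    proof (rule nn_integral_dominated_convergence[where w="\<lambda>t. indicator {-L..L} t * ennreal (norm (f t) powr p)"])
      show "AE t in lborel. indicator {-L..L} t * ennreal (norm (f t - fN N t) powr p)
          \<le> indicator {-L..L} t * ennreal (norm (f t) powr p)" for N
        by (intro AE_I2) (auto simp: fN_def indicator_def)
      show "AE t in lborel. (\<lambda>N. indicator {-L..L} t * ennreal (norm (f t - fN N t) powr p)) \<longlonglongrightarrow> 0"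
      proof (intro AE_I2 tendsto_eventually)
        fix t
        obtain N where "norm (f t) \<le> real N" using real_arch_simple by blast
        then have "indicator {-L..L} t * ennreal (norm (f t - fN n t) powr p) = 0" if "N \<le> n" for n
          using that by (auto simp: fN_def)
        then show "\<forall>\<^sub>F N in sequentially. indicator {-L..L} t * ennreal (norm (f t - fN N t) powr p) = 0"
          by (auto simp: eventually_sequentially)
      qed
    qed (use fin in auto)
    then have "\<forall>\<^sub>F N in sequentially. ?I (\<lambda>t. f t - fN N t) < ennreal e'"
      using e' by (intro order_tendstoD) auto
    then obtain N where N: "?I (\<lambda>t. f t - fN N t) < ennreal e'"
      by (auto simp: eventually_sequentially)
    \<comment> \<open>Measurable functions are limits almost everywhere of continuous ones. Composing with the nearest-point
      projection onto the ball of radius \<open>N\<close> keeps them continuous and bounds them by the same constant as the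
      truncation, hence a constant dominates on the interval.\<close>
    have "fN N \<in> borel_measurable (lebesgue_on UNIV)"
      by (simp add: lebesgue_on_UNIV_eq measurable_completion)
    then have "fN N measurable_on UNIV"
      by (simp add: measurable_on_iff_borel_measurable)
    then obtain Z c where Z: "negligible Z" and c: "\<And>n. continuous_on UNIV (c n :: real \<Rightarrow> 'k)"
      and lim: "\<And>t. t \<notin> Z \<Longrightarrow> (\<lambda>n. c n t) \<longlonglongrightarrow> fN N t"
      unfolding measurable_on_def by auto
    define P where "P = closest_point (cball (0::'k) (real N))"
    have contP: "continuous_on UNIV P"
      unfolding P_def by (rule continuous_on_closest_point) auto
    define d where "d = (\<lambda>n t. P (c n t))"
    have contd: "continuous_on UNIV (d n)" for n
      unfolding d_def using continuous_on_compose2[OF contP c] by auto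
    have d_meas[measurable]: "d n \<in> borel_measurable borel" for n
      using contd by (rule borel_measurable_continuous_onI)
    have d_le: "norm (d n t) \<le> real N" for n t
      using closest_point_in_set[of "cball (0::'k) (real N)" "c n t"] by (simp add: d_def P_def)
    have fN_le: "norm (fN N t) \<le> real N" for t by (simp add: fN_def)
    have "(\<lambda>n. ?I (\<lambda>t. fN N t - d n t)) \<longlonglongrightarrow> (\<integral>\<^sup>+t. 0 \<partial>(lborel :: real measure))"
    proof (rule nn_integral_dominated_convergence[where w="\<lambda>t. ennreal ((2 * real N) powr p) * indicator {-L..L} t"])
      show "AE t in lborel. indicator {-L..L} t * ennreal (norm (fN N t - d n t) powr p)
          \<le> ennreal ((2 * real N) powr p) * indicator {-L..L} t" for n
      proof (intro AE_I2)
        fix t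
        have "norm (fN N t - d n t) \<le> 2 * real N"
          using norm_triangle_ineq4[of "fN N t" "d n t"] fN_le[of t] d_le[of n t] by linarith
        then have "norm (fN N t - d n t) powr p \<le> (2 * real N) powr p"
          using p by (intro powr_mono2) auto
        then show "indicator {-L..L} t * ennreal (norm (fN N t - d n t) powr p)
          \<le> ennreal ((2 * real N) powr p) * indicator {-L..L} t"
          by (auto simp: indicator_def intro: ennreal_leI)
      qed
      have "AE t in lebesgue. t \<notin> Z"
        using Z by (simp add: negligible_iff_null_sets AE_not_in)
      then have "AE t in lborel. t \<notin> Z" by (simp add: AE_completion_iff)
      then show "AE t in lborel. (\<lambda>n. indicator {-L..L} t * ennreal (norm (fN N t - d n t) powr p)) \<longlonglongrightarrow> 0"
      proof eventually_elim
        fix t assume "t \<notin> Z"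
        have "P (fN N t) = fN N t"
          unfolding P_def using fN_le[of t] by (intro closest_point_self) auto
        moreover have "(\<lambda>n. P (c n t)) \<longlonglongrightarrow> P (fN N t)"
          using continuous_on_tendsto_compose[OF contP lim[OF \<open>t \<notin> Z\<close>]] by auto
        ultimately have "(\<lambda>n. d n t) \<longlonglongrightarrow> fN N t" by (simp add: d_def)
        then have "(\<lambda>n. norm (fN N t - d n t)) \<longlonglongrightarrow> norm (fN N t - fN N t)"
          by (intro tendsto_intros)
        then have "(\<lambda>n. norm (fN N t - d n t) powr p) \<longlonglongrightarrow> 0 powr p"
          using p by (intro tendsto_powr2) auto
        then have "(\<lambda>n. ennreal (norm (fN N t - d n t) powr p)) \<longlonglongrightarrow> ennreal 0"
          by (intro tendsto_ennrealI) simp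
        then show "(\<lambda>n. indicator {-L..L} t * ennreal (norm (fN N t - d n t) powr p)) \<longlonglongrightarrow> 0"
          by (cases "t \<in> {-L..L}") auto
      qed
      show "(\<integral>\<^sup>+t. ennreal ((2 * real N) powr p) * indicator {-L..L} t \<partial>lborel) < \<infinity>"
        using L by (subst nn_integral_cmult_indicator) (auto simp: ennreal_mult_less_top)
    qed auto
    then have "\<forall>\<^sub>F n in sequentially. ?I (\<lambda>t. fN N t - d n t) < ennreal e'"
      using e' by (intro order_tendstoD) auto
    then obtain n where n: "?I (\<lambda>t. fN N t - d n t) < ennreal e'"
      by (auto simp: eventually_sequentially)
    \<comment> \<open>With this \<open>\<eta>\<close>, a uniform error of \<open>2 \<eta>\<close> on an interval of length \<open>2 L\<close> contributes \<open>e' / 2\<close> to the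
      integral. The grid and the values are then chosen by uniform continuity and density.\<close>
    define \<eta> where "\<eta> = (e' / (4 * L)) powr (1 / p) / 2"
    have \<eta>: "0 < \<eta>" using e' L by (simp add: \<eta>_def)
    have "uniformly_continuous_on {-L..L} (d n)"
      by (intro compact_uniformly_continuous continuous_on_subset[OF contd]) auto
    then obtain \<delta> where \<delta>: "0 < \<delta>"
      "\<And>s t. s \<in> {-L..L} \<Longrightarrow> t \<in> {-L..L} \<Longrightarrow> dist s t < \<delta> \<Longrightarrow> dist (d n s) (d n t) < \<eta>"
      using \<eta> unfolding uniformly_continuous_on_def by metis
    obtain m :: nat where m: "1 / \<delta> < real m" using reals_Archimedean2 by blast
    have "0 < 1 / \<delta>" using \<delta>(1) by simp
    with m have m0: "0 < real m" by linarith
    have m\<delta>: "1 / real m < \<delta>" using m m0 \<delta>(1) by (simp add: field_simps)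
    have "\<forall>i. \<exists>q\<in>D. q \<in> ball (d n (real i / real m - L)) \<eta>"
      using D(2) \<eta> by (metis open_ball centre_in_ball empty_iff)
    then obtain q where q: "\<And>i. q i \<in> D" "\<And>i. dist (d n (real i / real m - L)) (q i) < \<eta>"
      by (auto simp: dist_commute) metis
    define qs where "qs = map q [0..<Suc (nat \<lfloor>real m * (2 * L)\<rfloor>)]"
    have near: "norm (d n t - step (m, qs) t) \<le> 2 * \<eta>" if t: "t \<in> {-L..L}" for t
    proof -
      define i where "i = nat \<lfloor>real m * (t + L)\<rfloor>"
      have "0 \<le> real m * (t + L)" using t m0 by auto
      then have i: "real i \<le> real m * (t + L)" "real m * (t + L) < real i + 1"
        unfolding i_def by linarith+
      have "real m * (t + L) \<le> real m * (2 * L)" using t m0 by auto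
      then have "i < length qs" unfolding i_def qs_def
        by (simp add: floor_mono nat_mono less_Suc_eq_le)
      then have st: "step (m, qs) t = q i"
        by (simp add: step_def Let_def i_def[symmetric]) (simp add: qs_def del: upt_Suc)
      have bd: "real i / real m \<le> t + L" "t + L < real i / real m + 1 / real m"
        using i m0 by (simp_all add: field_simps)
      moreover have "0 \<le> real i / real m" by simp
      ultimately have "dist (d n (real i / real m - L)) (d n t) < \<eta>"
        using t m\<delta> by (intro \<delta>(2)) (auto simp: dist_real_def)
      with q(2)[of i] have "dist (d n t) (q i) < 2 * \<eta>"
        using dist_triangle[of "d n t" "q i" "d n (real i / real m - L)"]
        by (simp add: dist_commute)
      then show ?thesis by (simp add: st dist_norm)
    qed
    have s_meas[measurable]: "step (m, qs) \<in> borel_measurable borel" by (rule step_meas)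
    have "?I (\<lambda>t. d n t - step (m, qs) t) \<le> (\<integral>\<^sup>+t. ennreal ((2 * \<eta>) powr p) * indicator {-L..L} t \<partial>lborel)"
      by (intro nn_integral_mono)
         (use p \<eta> near in \<open>auto simp: indicator_def intro!: ennreal_leI powr_mono2\<close>)
    also have "\<dots> = ennreal ((2 * \<eta>) powr p * (2 * L))"
      using L by (subst nn_integral_cmult_indicator) (auto simp: ennreal_mult)
    also have "(2 * \<eta>) powr p * (2 * L) = e' / 2"
      using p L e' by (simp add: \<eta>_def powr_powr)
    also have "ennreal (e' / 2) < ennreal e'" using e' by (simp add: ennreal_lessI)
    finally have s: "?I (\<lambda>t. d n t - step (m, qs) t) < ennreal e'" .
    have "?I (\<lambda>t. f t - step (m, qs) t) \<le> (\<integral>\<^sup>+t. ennreal (3 powr p) *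
        (indicator {-L..L} t * ennreal (norm (f t - fN N t) powr p)
         + indicator {-L..L} t * ennreal (norm (fN N t - d n t) powr p)
         + indicator {-L..L} t * ennreal (norm (d n t - step (m, qs) t) powr p)) \<partial>lborel)"
    proof (intro nn_integral_mono)
      fix t
      let ?u = "norm (f t - fN N t)" and ?v = "norm (fN N t - d n t)" and ?w = "norm (d n t - step (m, qs) t)"
      have "norm (f t - step (m, qs) t) \<le> ?u + ?v + ?w"
        by norm
      then have "norm (f t - step (m, qs) t) powr p \<le> (?u + ?v + ?w) powr p"
        using p by (intro powr_mono2) auto
      also have "\<dots> \<le> 3 powr p * (?u powr p + ?v powr p + ?w powr p)"
        using p by (intro powr_sum3_le) auto
      finally show "indicator {-L..L} t * ennreal (norm (f t - step (m, qs) t) powr p)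
        \<le> ennreal (3 powr p) * (indicator {-L..L} t * ennreal (?u powr p)
         + indicator {-L..L} t * ennreal (?v powr p) + indicator {-L..L} t * ennreal (?w powr p))"
        by (auto simp: indicator_def ennreal_mult[symmetric] ennreal_plus[symmetric]
                 simp del: ennreal_plus intro!: ennreal_leI)
    qed
    also have "\<dots> = ennreal (3 powr p) * (?I (\<lambda>t. f t - fN N t) + ?I (\<lambda>t. fN N t - d n t)
         + ?I (\<lambda>t. d n t - step (m, qs) t))"
      by (simp add: nn_integral_cmult nn_integral_add)
    also have "\<dots> \<le> ennreal (3 powr p) * (ennreal e' + ennreal e' + ennreal e')"
      using N n s by (intro mult_left_mono add_mono) auto
    also have "\<dots> = ennreal (3 powr p * (3 * e'))"
      using e' by (simp add: ennreal_mult[symmetric] ennreal_plus[symmetric] del: ennreal_plus)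
    also have "3 powr p * (3 * e') = 3 / 4 * e" by (simp add: e'_def)
    also have "ennreal (3 / 4 * e) < ennreal e" using e by (simp add: ennreal_lessI)
    finally have "?I (\<lambda>t. f t - step (m, qs) t) < ennreal e" .
    moreover have "(m, qs) \<in> ?C" using q(1) by (auto simp: qs_def)
    then obtain k where "from_nat_into ?C k = (m, qs)"
      using from_nat_into_surj[OF C(1)] by metis
    ultimately show "\<exists>k. ?I (\<lambda>t. f t - step (from_nat_into ?C k) t) < ennreal e"
      by metis
  qed (use step_meas step_LI in auto)
qed

section \<open>Orbits of a measure-preserving flow\<close>

text \<open>Scalar functions suffice to test measurability of the flow map: apply the hypothesis to
  indicator functions.\<close>

lemma measurable_flow_if_functions_measurable:
  fixes U :: "real \<Rightarrow> 'a \<Rightarrow> 'a"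
  assumes "measure_preserving_flow M U"
    and "\<And>f :: 'a \<Rightarrow> 'k::{real_normed_field, euclidean_space}. f \<in> borel_measurable M \<Longrightarrow>
           (\<lambda>(t, x). f (U t x)) \<in> borel_measurable (completion (lborel \<Otimes>\<^sub>M M))"
  shows "(\<lambda>(t, x). U t x) \<in> completion (lborel \<Otimes>\<^sub>M M) \<rightarrow>\<^sub>M M"
proof (rule measurableI)
  fix z :: "real \<times> 'a" assume "z \<in> space (completion (lborel \<Otimes>\<^sub>M M))"
  then show "(case z of (t, x) \<Rightarrow> U t x) \<in> space M"
    using assms(1) by (auto simp: measure_preserving_flow_def space_pair_measure intro: measurable_space)
next
  fix A assume A: "A \<in> sets M"
  define i :: "'a \<Rightarrow> 'k" where "i = (\<lambda>x. if x \<in> A then 1 else 0)"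
  have "i \<in> borel_measurable M" using A unfolding i_def by measurable
  from measurable_sets[OF assms(2)[OF this], of "{1}"]
  show "(\<lambda>(t, x). U t x) -` A \<inter> space (completion (lborel \<Otimes>\<^sub>M M)) \<in> sets (completion (lborel \<Otimes>\<^sub>M M))"
    by (simp add: i_def vimage_def split_beta if_split_eq1 cong: conj_cong)
qed

lemma completion_ex_borel_measurable_euclidean:
  fixes g :: "'a \<Rightarrow> 'k::euclidean_space"
  assumes "g \<in> borel_measurable (completion M)"
  shows "\<exists>g'\<in>borel_measurable M. AE x in M. g x = g' x"
proof -
  have "\<forall>b\<in>Basis. \<exists>c\<in>borel_measurable M. AE x in M. g x \<bullet> b = c x"
    using assms by (auto intro!: completion_ex_borel_measurable_real)
  then obtain c where c: "\<And>b. b \<in> Basis \<Longrightarrow> c b \<in> borel_measurable M"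
    "\<And>b. b \<in> Basis \<Longrightarrow> AE x in M. g x \<bullet> b = c b x"
    by metis
  show ?thesis
  proof
    show "(\<lambda>x. \<Sum>b\<in>Basis. c b x *\<^sub>R b) \<in> borel_measurable M"
      using c(1) by measurable
    have "AE x in M. \<forall>b\<in>Basis. g x \<bullet> b = c b x"
      using c(2) by (intro AE_finite_allI) auto
    then show "AE x in M. g x = (\<Sum>b\<in>Basis. c b x *\<^sub>R b)"
    proof eventually_elim
      case (elim x)
      then have "(\<Sum>b\<in>Basis. c b x *\<^sub>R b) = (\<Sum>b\<in>Basis. (g x \<bullet> b) *\<^sub>R b)"
        by (intro sum.cong) auto
      then show ?case by (simp add: euclidean_representation)
    qed
  qed
qed

lemma (in pair_sigma_finite) AE_pair_swap:
  assumes "AE z in M1 \<Otimes>\<^sub>M M2. Q z"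
  shows "AE y in M2. AE x in M1. Q (x, y)"
proof -
  interpret Q: pair_sigma_finite M2 M1 ..
  have "AE z in distr (M2 \<Otimes>\<^sub>M M1) (M1 \<Otimes>\<^sub>M M2) (\<lambda>(x, y). (y, x)). Q z"
    using assms by (subst distr_pair_swap[symmetric])
  then have "AE z in M2 \<Otimes>\<^sub>M M1. Q (case z of (x, y) \<Rightarrow> (y, x))"
    by (rule AE_distrD[OF measurable_pair_swap'])
  from Q.AE_pair[OF this] show ?thesis by simp
qed

text \<open>The flow map is jointly measurable only with respect to the completed product measure. Orbit functions
  are therefore replaced below by versions measurable for the product \<open>\<sigma>\<close>-algebra itself, which agree
  with them at almost every time along almost every orbit, and to which Tonelli applies.\<close>

locale measurable_flow = sigma_finite_measure M for M :: "'a measure" +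
  fixes U :: "real \<Rightarrow> 'a \<Rightarrow> 'a"
  assumes flow: "measure_preserving_flow M U"
    and jointly_measurable: "(\<lambda>(t, x). U t x) \<in> completion (lborel \<Otimes>\<^sub>M M) \<rightarrow>\<^sub>M M"
begin

sublocale time: pair_sigma_finite lborel M ..

lemma flow_measurable [measurable]: "U t \<in> M \<rightarrow>\<^sub>M M"
  using flow by (auto simp: measure_preserving_flow_def)

lemma flow_space: "x \<in> space M \<Longrightarrow> U t x \<in> space M"
  by (rule measurable_space[OF flow_measurable])

lemma flow_add: "x \<in> space M \<Longrightarrow> U (s + t) x = U s (U t x)"
  using flow by (auto simp: measure_preserving_flow_def)

lemma distr_flow: "distr M M (U t) = M"
  by (rule measure_eqI) (use flow in \<open>auto simp: emeasure_distr measure_preserving_flow_def\<close>)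

lemma nn_integral_flow:
  assumes "W \<in> borel_measurable M"
  shows "(\<integral>\<^sup>+x. W (U t x) \<partial>M) = (\<integral>\<^sup>+x. W x \<partial>M)"
  using nn_integral_distr[OF flow_measurable, of W t] assms by (simp add: distr_flow)

lemma flow_function_version:
  assumes [measurable]: "W \<in> borel_measurable M"
  shows "(\<lambda>z. W (U (fst z) (snd z))) \<in> borel_measurable (completion (lborel \<Otimes>\<^sub>M M))"
  using measurable_compose[OF jointly_measurable assms] by (simp add: split_beta)

lemma orbit_version:
  fixes f :: "'a \<Rightarrow> 'k::euclidean_space"
  assumes "f \<in> borel_measurable M"
  obtains F where "F \<in> borel_measurable (lborel \<Otimes>\<^sub>M M)"
    "AE x in M. AE t in lborel. f (U t x) = F (t, x)"
proof -
  obtain F where "F \<in> borel_measurable (lborel \<Otimes>\<^sub>M M)"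
    "AE z in lborel \<Otimes>\<^sub>M M. f (U (fst z) (snd z)) = F z"
    using completion_ex_borel_measurable_euclidean[OF flow_function_version[OF assms]] by auto
  then show ?thesis using that time.AE_pair_swap by fastforce
qed

text \<open>The identity at the centre of the transfer: integrating \<open>W (U t x)\<close> over times in \<open>B\<close> and over all
  \<open>x\<close> gives \<open>\<bar>B\<bar>\<close> times the integral of \<open>W\<close>, by Tonelli and the invariance of the measure under each \<open>U t\<close>.\<close>

lemma orbit_integral:
  fixes W :: "'a \<Rightarrow> ennreal"
  assumes W: "W \<in> borel_measurable M"
  obtains V where "V \<in> borel_measurable (lborel \<Otimes>\<^sub>M M)"
    "AE x in M. AE t in lborel. W (U t x) = V (t, x)"
    "\<And>B. B \<in> sets borel \<Longrightarrow>
      (\<integral>\<^sup>+x. \<integral>\<^sup>+t. indicator B t * V (t, x) \<partial>lborel \<partial>M) = emeasure lborel B * (\<integral>\<^sup>+x. W x \<partial>M)"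
proof -
  obtain V where V[measurable]: "V \<in> borel_measurable (lborel \<Otimes>\<^sub>M M)"
    and eq: "AE z in lborel \<Otimes>\<^sub>M M. W (U (fst z) (snd z)) = V z"
    using completion_ex_borel_measurable[OF flow_function_version[OF W]] by auto
  show ?thesis
  proof (rule that[OF V])
    show "AE x in M. AE t in lborel. W (U t x) = V (t, x)"
      using time.AE_pair_swap[OF eq] by simp
    fix B :: "real set" assume B[measurable]: "B \<in> sets borel"
    have "(\<integral>\<^sup>+x. \<integral>\<^sup>+t. indicator B t * V (t, x) \<partial>lborel \<partial>M)
        = (\<integral>\<^sup>+t. \<integral>\<^sup>+x. indicator B t * V (t, x) \<partial>M \<partial>lborel)"
      using time.Fubini[of "\<lambda>z. indicator B (fst z) * V z"] by simp
    also have "\<dots> = (\<integral>\<^sup>+t. indicator B t * (\<integral>\<^sup>+x. V (t, x) \<partial>M) \<partial>lborel)"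
      by (intro nn_integral_cong nn_integral_cmult) measurable
    also have "\<dots> = (\<integral>\<^sup>+t. (\<integral>\<^sup>+x. W x \<partial>M) * indicator B t \<partial>lborel)"
    proof (rule nn_integral_cong_AE)
      from time.AE_pair[OF eq]
      show "AE t in lborel. indicator B t * (\<integral>\<^sup>+x. V (t, x) \<partial>M) = (\<integral>\<^sup>+x. W x \<partial>M) * indicator B t"
      proof eventually_elim
        case (elim t)
        then have "(\<integral>\<^sup>+x. V (t, x) \<partial>M) = (\<integral>\<^sup>+x. W (U t x) \<partial>M)"
          by (intro nn_integral_cong_AE) auto
        then show ?case by (simp add: nn_integral_flow[OF W] mult.commute)
      qed
    qed
    also have "\<dots> = emeasure lborel B * (\<integral>\<^sup>+x. W x \<partial>M)"
      by (subst nn_integral_cmult_indicator) (auto simp: mult.commute)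
    finally show "(\<integral>\<^sup>+x. \<integral>\<^sup>+t. indicator B t * V (t, x) \<partial>lborel \<partial>M) = emeasure lborel B * (\<integral>\<^sup>+x. W x \<partial>M)" .
  qed
qed

text \<open>The previous identity for the indicator function of a null set, with all of \<open>\<real>\<close> as the set of times: its
  right-hand side is \<open>\<infinity> * 0 = 0\<close>, so almost every orbit spends almost no time in the null set.\<close>

lemma AE_orbit:
  assumes "AE x in M. P x"
  shows "AE x in M. AE t in lborel. P (U t x)"
proof -
  obtain N where N: "N \<in> null_sets M" "{x \<in> space M. \<not> P x} \<subseteq> N"
    using assms by (auto simp: eventually_ae_filter)
  have [measurable]: "N \<in> sets M" using N by auto
  obtain V where V[measurable]: "V \<in> borel_measurable (lborel \<Otimes>\<^sub>M M)"
    and eq: "AE x in M. AE t in lborel. indicator N (U t x) = V (t, x)"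
    and int: "\<And>B. B \<in> sets borel \<Longrightarrow> (\<integral>\<^sup>+x. \<integral>\<^sup>+t. indicator B t * V (t, x) \<partial>lborel \<partial>M)
        = emeasure lborel B * (\<integral>\<^sup>+x. indicator N x \<partial>M)"
    using orbit_integral[of "indicator N"] by auto
  have "(\<integral>\<^sup>+x. \<integral>\<^sup>+t. V (t, x) \<partial>lborel \<partial>M) = 0"
    using int[of UNIV] null_setsD1[OF N(1)] by simp
  then have "AE x in M. (\<integral>\<^sup>+t. V (t, x) \<partial>lborel) = 0"
    by (subst (asm) nn_integral_0_iff_AE) auto
  then show ?thesis
    using eq AE_space
  proof eventually_elim
    case (elim x)
    have "AE t in lborel. V (t, x) = 0"
      using elim(1,3) by (subst (asm) nn_integral_0_iff_AE) auto
    with elim(2) show ?case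
    proof eventually_elim
      case (elim t)
      then have "U t x \<notin> N" by (auto simp: indicator_def split: if_splits)
      then show ?case using N(2) flow_space[OF \<open>x \<in> space M\<close>] by auto
    qed
  qed
qed

text \<open>The bounded part is harmless, and for the integrable part \<open>h\<close> the integral of \<open>\<bar>h\<bar>\<close> along orbits over a
  bounded set of times has finite integral over the whole space.\<close>

lemma orbit_locally_integrable:
  fixes f :: "'a \<Rightarrow> 'k::euclidean_space"
  assumes "bounded_plus_integrable M f"
  shows "AE x in M. locally_integrable (\<lambda>t. f (U t x))"
proof -
  obtain g h where g: "g \<in> borel_measurable M" "bounded (g ` space M)" and h: "integrable M h"
    and fgh: "\<And>x. x \<in> space M \<Longrightarrow> f x = g x + h x"
    using assms by (auto simp: bounded_plus_integrable_def)
  have [measurable]: "h \<in> borel_measurable M" using h by auto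
  obtain b where b: "\<And>x. x \<in> space M \<Longrightarrow> norm (g x) \<le> b"
    using g(2) by (auto simp: bounded_iff)
  have "f \<in> borel_measurable M"
    using g(1) fgh by (subst measurable_cong[where g="\<lambda>x. g x + h x"]) auto
  then obtain F where F[measurable]: "F \<in> borel_measurable (lborel \<Otimes>\<^sub>M M)"
    and Feq: "AE x in M. AE t in lborel. f (U t x) = F (t, x)"
    by (rule orbit_version)
  obtain V where V[measurable]: "V \<in> borel_measurable (lborel \<Otimes>\<^sub>M M)"
    and Veq: "AE x in M. AE t in lborel. ennreal (norm (h (U t x))) = V (t, x)"
    and int: "\<And>B. B \<in> sets borel \<Longrightarrow> (\<integral>\<^sup>+x. \<integral>\<^sup>+t. indicator B t * V (t, x) \<partial>lborel \<partial>M)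
        = emeasure lborel B * (\<integral>\<^sup>+x. ennreal (norm (h x)) \<partial>M)"
    using orbit_integral[of "\<lambda>x. ennreal (norm (h x))"] by auto
  have "AE x in M. \<forall>n::nat. (\<integral>\<^sup>+t. indicator {-real n..real n} t * V (t, x) \<partial>lborel) \<noteq> \<infinity>"
    unfolding AE_all_countable
  proof
    fix n :: nat
    show "AE x in M. (\<integral>\<^sup>+t. indicator {-real n..real n} t * V (t, x) \<partial>lborel) \<noteq> \<infinity>"
      using int[of "{-real n..real n}"] h
      by (intro nn_integral_PInf_AE) (auto simp: ennreal_mult_eq_top_iff integrable_iff_bounded)
  qed
  with Feq Veq AE_space show ?thesis
  proof eventually_elim
    case (elim x)
    have [measurable]: "(\<lambda>t. F (t, x)) \<in> borel_measurable borel"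
      using measurable_compose[OF measurable_Pair2'[OF elim(3)] F] by simp
    have [measurable]: "(\<lambda>t. V (t, x)) \<in> borel_measurable borel"
      using measurable_compose[OF measurable_Pair2'[OF elim(3)] V] by simp
    show ?case
      unfolding locally_integrable_iff
    proof (intro conjI allI)
      show "(\<lambda>t. f (U t x)) \<in> borel_measurable lebesgue"
        by (rule borel_measurable_AE[of "\<lambda>t. F (t, x)"])
           (use elim(1) in \<open>auto intro!: measurable_completion AE_completion simp: eq_commute\<close>)
      fix n :: nat
      let ?i = "indicator {-real n..real n} :: real \<Rightarrow> ennreal"
      have "(\<integral>\<^sup>+t. ?i t * ennreal (norm (f (U t x))) \<partial>lebesgue)
          = (\<integral>\<^sup>+t. ?i t * ennreal (norm (f (U t x))) \<partial>lborel)"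
        by (rule nn_integral_completion)
      also have "\<dots> \<le> (\<integral>\<^sup>+t. ennreal b * ?i t + ?i t * V (t, x) \<partial>lborel)"
      proof (rule nn_integral_mono_AE)
        show "AE t in lborel. ?i t * ennreal (norm (f (U t x))) \<le> ennreal b * ?i t + ?i t * V (t, x)"
          using elim(2)
        proof eventually_elim
          case (elim t)
          have "norm (f (U t x)) \<le> b + norm (h (U t x))"
            using b[OF flow_space[OF \<open>x \<in> space M\<close>], of t] fgh[OF flow_space[OF \<open>x \<in> space M\<close>], of t]
              norm_triangle_ineq[of "g (U t x)" "h (U t x)"] by simp
          then have "ennreal (norm (f (U t x))) \<le> ennreal b + ennreal (norm (h (U t x)))"
            using order_trans[OF norm_ge_zero b[OF \<open>x \<in> space M\<close>]]
            by (simp add: ennreal_plus[symmetric] ennreal_leI del: ennreal_plus)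
          with elim show ?case by (auto simp: indicator_def)
        qed
      qed
      also have "\<dots> = ennreal b * emeasure lborel {-real n..real n} + (\<integral>\<^sup>+t. ?i t * V (t, x) \<partial>lborel)"
        by (subst nn_integral_add) (auto simp: nn_integral_cmult_indicator)
      also have "\<dots> < \<infinity>"
        using elim(4) by (auto simp: ennreal_mult_less_top top.not_eq_extremum)
      finally show "(\<integral>\<^sup>+t. ?i t * ennreal (norm (f (U t x))) \<partial>lebesgue) < \<infinity>" .
    qed
  qed
qed

end

section \<open>Measurability of transferred operators\<close>

text \<open>Recovers the value of a continuous function at \<open>0\<close> from a version \<open>H\<close> that is correct only at almost
  every time. This is how a value at the single time \<open>0\<close>, the value of a transferred operator, is reached
  by statements that hold at almost every time.\<close>

lemma averages_tendsto:
  fixes u :: "real \<Rightarrow> real" and H :: "real \<Rightarrow> ennreal"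
  assumes u: "continuous_on UNIV u" "\<And>t. 0 \<le> u t"
    and H: "AE t in lborel. \<bar>t\<bar> \<le> 1 \<longrightarrow> H t = ennreal (u t)"
  shows "(\<lambda>n. (\<integral>\<^sup>+t. indicator {-1 / real (Suc n)..1 / real (Suc n)} t * H t \<partial>lborel)
      * ennreal (real (Suc n) / 2)) \<longlonglongrightarrow> ennreal (u 0)"
    (is "?Q \<longlonglongrightarrow> _")
proof -
  have const: "(\<integral>\<^sup>+t. ennreal a * indicator {-1 / real (Suc n)..1 / real (Suc n)} t \<partial>lborel)
      * ennreal (real (Suc n) / 2) = ennreal a" for a n
  proof -
    have "(\<integral>\<^sup>+t. ennreal a * indicator {-1 / real (Suc n)..1 / real (Suc n)} t \<partial>lborel)
      = ennreal a * ennreal (2 / real (Suc n))"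
      by (subst nn_integral_cmult_indicator) auto
    moreover have "ennreal (2 / real (Suc n)) * ennreal (real (Suc n) / 2) = 1"
      by (subst ennreal_mult[symmetric]) auto
    ultimately show ?thesis by (simp add: mult.assoc)
  qed
  have sq: "\<forall>\<^sub>F n in sequentially. ennreal (u 0 - e) \<le> ?Q n \<and> ?Q n \<le> ennreal (u 0 + e)" if "0 < e" for e
  proof -
    have "isCont u 0" using u(1) by (simp add: continuous_on_eq_continuous_at)
    then obtain d where d: "0 < d" "\<And>t. \<bar>t\<bar> < d \<Longrightarrow> \<bar>u t - u 0\<bar> < e"
      using \<open>0 < e\<close> unfolding continuous_at_eps_delta by (auto simp: dist_real_def)
    obtain N where N: "1 / d < real N" using reals_Archimedean2 by blast
    have "ennreal (u 0 - e) \<le> ?Q n \<and> ?Q n \<le> ennreal (u 0 + e)" if "N \<le> n" for n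
    proof -
      let ?I = "{-1 / real (Suc n)..1 / real (Suc n)}"
      have "1 / d < real (Suc n)" using N that by linarith
      then have n: "1 / real (Suc n) < d" using d(1) by (simp add: field_simps)
      have n1: "1 / real (Suc n) \<le> 1" by simp
      have near: "\<bar>t\<bar> \<le> 1 \<and> \<bar>u t - u 0\<bar> < e" if "t \<in> ?I" for t
      proof -
        have "\<bar>t\<bar> \<le> 1 / real (Suc n)" using that by auto
        with n n1 show ?thesis using d(2)[of t] by linarith
      qed
      have lower: "(\<integral>\<^sup>+t. ennreal (u 0 - e) * indicator ?I t \<partial>lborel) \<le> (\<integral>\<^sup>+t. indicator ?I t * H t \<partial>lborel)"
      proof (rule nn_integral_mono_AE)
        show "AE t in lborel. ennreal (u 0 - e) * indicator ?I t \<le> indicator ?I t * H t"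
          using H
        proof eventually_elim
          case (elim t)
          show ?case
          proof (cases "t \<in> ?I")
            case True
            then show ?thesis using near[OF True] elim by (auto intro!: ennreal_leI)
          next
            case False
            then show ?thesis
              by (simp only: indicator_simps(2)[OF False] mult_zero_left mult_zero_right order_refl)
          qed
        qed
      qed
      have upper: "(\<integral>\<^sup>+t. indicator ?I t * H t \<partial>lborel) \<le> (\<integral>\<^sup>+t. ennreal (u 0 + e) * indicator ?I t \<partial>lborel)"
      proof (rule nn_integral_mono_AE)
        show "AE t in lborel. indicator ?I t * H t \<le> ennreal (u 0 + e) * indicator ?I t"
          using H
        proof eventually_elim
          case (elim t)
          show ?case
          proof (cases "t \<in> ?I")
            case True
            then show ?thesis using near[OF True] elim by (auto intro!: ennreal_leI)
          next
            case False
            then show ?thesis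
              by (simp only: indicator_simps(2)[OF False] mult_zero_left mult_zero_right order_refl)
          qed
        qed
      qed
      show ?thesis
        using mult_right_mono[OF lower zero_le, of "ennreal (real (Suc n) / 2)"]
          mult_right_mono[OF upper zero_le, of "ennreal (real (Suc n) / 2)"]
        unfolding const by blast
    qed
    then show ?thesis by (auto simp: eventually_sequentially)
  qed
  show ?thesis
  proof (rule order_tendstoI)
    fix a assume "a < ennreal (u 0)"
    then obtain r where r: "a = ennreal r" "0 \<le> r" "r < u 0"
      by (cases a) (auto simp: ennreal_less_iff)
    then have e: "0 < (u 0 - r) / 2" by simp
    from sq[OF e] show "\<forall>\<^sub>F n in sequentially. a < ?Q n"
    proof eventually_elim
      case (elim n)
      have "a < ennreal (u 0 - (u 0 - r) / 2)" using r by (auto simp: ennreal_less_iff field_simps)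
      with elim show ?case by auto
    qed
  next
    fix a assume a: "ennreal (u 0) < a"
    obtain r where r: "u 0 < r" "ennreal r \<le> a"
    proof (cases a)
      case (real r)
      with a that[of r] show ?thesis using u(2) by (auto simp: ennreal_less_iff)
    next
      case top
      with that[of "u 0 + 1"] show ?thesis by auto
    qed
    then have e: "0 < (r - u 0) / 2" by simp
    from sq[OF e] show "\<forall>\<^sub>F n in sequentially. ?Q n < a"
    proof eventually_elim
      case (elim n)
      have "ennreal (u 0 + (r - u 0) / 2) < ennreal r" using r u(2)[of 0] by (auto simp: ennreal_less_iff field_simps)
      with elim r show ?case by auto
    qed
  qed
qed

definition weak_type ::
  "((real \<Rightarrow> 'k::{real_normed_field, euclidean_space}) \<Rightarrow> real \<Rightarrow> 'k) \<Rightarrow> real \<Rightarrow> real \<Rightarrow> bool" where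
  "weak_type T p c \<longleftrightarrow> (\<forall>g l. locally_integrable g \<longrightarrow> 0 < l \<longrightarrow>
     emeasure lebesgue {t. l < norm (T g t)}
     \<le> ennreal (c powr p / l powr p) * (\<integral>\<^sup>+t. ennreal (norm (g t) powr p) \<partial>lebesgue))"

text \<open>Continuity of \<open>f \<mapsto> \<bar>T f\<bar>\<close> along fast sequences. The weak type bound controls the measure of the times at
  which \<open>\<bar>T (f - s m)\<bar>\<close> exceeds a level by a multiple of \<open>2\<^sup>-\<^sup>m\<close>; these measures are summable, so
  Borel--Cantelli applies. Semilocality allows the distance of \<open>f\<close> and \<open>s m\<close> to be measured on a bounded
  interval only.\<close>

lemma weak_type_AE_convergence:
  assumes T: "admissible T" "weak_type T p c"
    and semilocal: "semilocal T \<epsilon>"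
    and f: "locally_integrable f" and s: "\<And>m. locally_integrable (s m)"
    and fs: "\<And>m::nat. (\<integral>\<^sup>+t. indicator {-(1 + \<epsilon>)..1 + \<epsilon>} t * ennreal (norm (f t - s m t) powr p) \<partial>lebesgue)
        < ennreal ((1 / 2) ^ m)"
  shows "AE t in lebesgue. \<bar>t\<bar> \<le> 1 \<longrightarrow> (\<lambda>m. norm (T (s m) t)) \<longlonglongrightarrow> norm (T f t)"
proof -
  let ?I = "{-(1 + \<epsilon>)..1 + \<epsilon>}"
  define D where "D = (\<lambda>m t. indicator ?I t *\<^sub>R (f t - s m t))"
  have D: "locally_integrable (D m)" for m
    unfolding D_def by (intro locally_integrable_restrict locally_integrable_diff f s) auto
  have small: "AE t in lebesgue. \<forall>\<^sub>F m in sequentially. norm (T (D m) t) \<le> l" if l: "0 < l" for l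
  proof -
    define E where "E = (\<lambda>m. {t. l < norm (T (D m) t)})"
    have "open (E m)" for m
      unfolding E_def using admissible_continuous[OF T(1) D]
      by (intro open_Collect_less continuous_intros) auto
    then have E[measurable]: "E m \<in> sets lebesgue" for m by simp
    have bound: "emeasure lebesgue (E m) \<le> ennreal (c powr p / l powr p * (1 / 2) ^ m)" for m
    proof -
      have "emeasure lebesgue (E m)
          \<le> ennreal (c powr p / l powr p) * (\<integral>\<^sup>+t. ennreal (norm (D m t) powr p) \<partial>lebesgue)"
        using T(2) D l unfolding weak_type_def E_def by blast
      also have "(\<integral>\<^sup>+t. ennreal (norm (D m t) powr p) \<partial>lebesgue)
          = (\<integral>\<^sup>+t. indicator ?I t * ennreal (norm (f t - s m t) powr p) \<partial>lebesgue)"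
        by (intro nn_integral_cong) (auto simp: D_def indicator_def)
      also have "ennreal (c powr p / l powr p) * \<dots> \<le> ennreal (c powr p / l powr p) * ennreal ((1 / 2) ^ m)"
        using fs[of m] by (intro mult_left_mono) auto
      finally show ?thesis by (simp add: ennreal_mult[symmetric])
    qed
    have "AE t in lebesgue. \<forall>\<^sub>F m in sequentially. t \<in> space lebesgue - E m"
    proof (rule borel_cantelli_AE1[OF E])
      show "emeasure lebesgue (E m) < \<infinity>" for m
        using bound[of m] by (rule order.strict_trans1) simp
      show "summable (\<lambda>m. measure lebesgue (E m))"
      proof (rule summable_comparison_test')
        show "summable (\<lambda>m. c powr p / l powr p * (1 / 2) ^ m)"
          by (intro summable_mult summable_geometric) auto
        show "norm (measure lebesgue (E m)) \<le> c powr p / l powr p * (1 / 2) ^ m" for m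
          using bound[of m] by (auto simp: measure_def intro!: enn2real_leI)
      qed
    qed
    then show ?thesis
      by (rule eventually_mono) (auto simp: E_def elim!: eventually_mono)
  qed
  have "AE t in lebesgue. \<forall>i::nat. \<forall>\<^sub>F m in sequentially. norm (T (D m) t) \<le> 1 / real (Suc i)"
    unfolding AE_all_countable by (intro allI small) auto
  then show ?thesis
  proof (rule eventually_mono, intro impI)
    fix t assume small: "\<forall>i::nat. \<forall>\<^sub>F m in sequentially. norm (T (D m) t) \<le> 1 / real (Suc i)"
      and t: "\<bar>t\<bar> \<le> 1"
    have "\<bar>norm (T (s m) t) - norm (T f t)\<bar> \<le> norm (T (D m) t)" for m
    proof -
      have "norm (T (\<lambda>r. f r - s m r) t) = norm (T (D m) t)"
      proof (rule semilocalD[OF semilocal])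
        show "locally_integrable (\<lambda>r. f r - s m r)" by (intro locally_integrable_diff f s)
        show "locally_integrable (D m)" by (rule D)
        show "AE r in lebesgue. r \<in> {-(1 + \<epsilon>)<..<1 + \<epsilon>} \<longrightarrow> f r - s m r = D m r"
          by (auto simp: D_def)
      qed (use t in auto)
      then show ?thesis
        using admissible_diff[OF T(1) f s[of m], of t] by (simp add: abs_minus_commute)
    qed
    note close = this
    show "(\<lambda>m. norm (T (s m) t)) \<longlonglongrightarrow> norm (T f t)"
    proof (rule LIMSEQ_I)
      fix e :: real assume "0 < e"
      then obtain i where i: "1 / real (Suc i) < e"
        using nat_approx_posE by blast
      from small obtain N where "\<And>m. N \<le> m \<Longrightarrow> norm (T (D m) t) \<le> 1 / real (Suc i)"
        by (auto simp: eventually_sequentially)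
      with i close show "\<exists>N. \<forall>m\<ge>N. norm (norm (T (s m) t) - norm (T f t)) < e"
        by (metis le_less_trans order_trans real_norm_def)
    qed
  qed
qed

lemma measurable_completion_AE:
  fixes g h :: "'a \<Rightarrow> 'b::topological_space"
  assumes g: "g \<in> borel_measurable (completion M)" and eq: "AE x in M. g x = h x"
  shows "h \<in> borel_measurable (completion M)"
proof (rule measurableI)
  fix A :: "'b set" assume "A \<in> sets borel"
  then have gA: "g -` A \<inter> space (completion M) \<in> sets (completion M)"
    using g by (rule measurable_sets[rotated])
  have "AE x in completion M.
      x \<in> g -` A \<inter> space (completion M) \<longleftrightarrow> x \<in> h -` A \<inter> space (completion M)"
    using AE_completion[OF eq] by eventually_elim auto
  from completion.in_sets_AE[OF this gA]
  show "h -` A \<inter> space (completion M) \<in> sets (completion M)" by blast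
qed auto

context measurable_flow
begin

text \<open>Admissibility does not include continuity of \<open>T\<close> in any topology on locally integrable functions, so
  measurability of \<open>\<bar>T\<^sup>\<sharp> f\<bar>\<close> has to come from the weak type bound. From a countable set of step functions \<open>g k\<close>
  dense in \<open>L\<^sup>p\<close> of an interval, choose for each \<open>x\<close> the first index \<open>k m x\<close> with \<open>g (k m x)\<close> close to the
  orbit function of \<open>x\<close>. This choice is measurable in \<open>x\<close> and takes countably many values, so the function
  \<open>\<bar>T (g (k m x)) t\<bar>\<close> is jointly measurable in \<open>t\<close> and \<open>x\<close>, and it converges to the value along the orbit for
  almost every \<open>t\<close> near \<open>0\<close>.\<close>

lemma transferred_measurable:
  fixes f :: "'a \<Rightarrow> 'k::{real_normed_field, euclidean_space}"
  assumes T: "admissible T" "weak_type T p c" and p: "1 \<le> p"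
    and f: "bounded_plus_integrable M f"
    and fin: "(\<integral>\<^sup>+x. ennreal (norm (f x) powr p) \<partial>M) < \<infinity>"
  shows "(\<lambda>x. ennreal (norm (transferred U T f x))) \<in> borel_measurable (completion M)"
proof -
  obtain \<epsilon> where \<epsilon>: "0 < \<epsilon>" and semilocal: "semilocal T \<epsilon>"
    using admissible_semilocal[OF T(1)] by blast
  let ?L = "1 + \<epsilon>"
  let ?i = "indicator {-?L..?L} :: real \<Rightarrow> ennreal"
  have fm[measurable]: "f \<in> borel_measurable M"
    using f by (auto simp: bounded_plus_integrable_def cong: measurable_cong)
  obtain F where F[measurable]: "F \<in> borel_measurable (lborel \<Otimes>\<^sub>M M)"
    and Feq: "AE x in M. AE t in lborel. f (U t x) = F (t, x)"
    using orbit_version[OF fm] .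
  obtain V where V[measurable]: "V \<in> borel_measurable (lborel \<Otimes>\<^sub>M M)"
    and Veq: "AE x in M. AE t in lborel. ennreal (norm (f (U t x)) powr p) = V (t, x)"
    and int: "\<And>B. B \<in> sets borel \<Longrightarrow> (\<integral>\<^sup>+x. \<integral>\<^sup>+t. indicator B t * V (t, x) \<partial>lborel \<partial>M)
        = emeasure lborel B * (\<integral>\<^sup>+x. ennreal (norm (f x) powr p) \<partial>M)"
    using orbit_integral[of "\<lambda>x. ennreal (norm (f x) powr p)"] by auto
  have Vfin: "AE x in M. (\<integral>\<^sup>+t. ?i t * V (t, x) \<partial>lborel) \<noteq> \<infinity>"
    using int[of "{-?L..?L}"] fin \<epsilon>
    by (intro nn_integral_PInf_AE) (auto simp: ennreal_mult_eq_top_iff)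
  have L0: "0 < ?L" using \<epsilon> by simp
  obtain g :: "nat \<Rightarrow> real \<Rightarrow> 'k" where g[measurable]: "\<And>k. g k \<in> borel_measurable borel"
    and gLI: "\<And>k. locally_integrable (g k)"
    and dense: "\<And>h e. \<lbrakk>h \<in> borel_measurable borel; 0 < e;
       (\<integral>\<^sup>+t. ?i t * ennreal (norm (h t) powr p) \<partial>lborel) < \<infinity>\<rbrakk> \<Longrightarrow>
       \<exists>k. (\<integral>\<^sup>+t. ?i t * ennreal (norm (h t - g k t) powr p) \<partial>lborel) < ennreal e"
    by (rule countable_dense_step_functions[OF p L0], rule that) blast+
  define k where "k = (\<lambda>m x. LEAST k. (\<integral>\<^sup>+t. ?i t * ennreal (norm (F (t, x) - g k t) powr p) \<partial>lborel)
      < ennreal ((1 / 2) ^ m))"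
  have k[measurable]: "k m \<in> M \<rightarrow>\<^sub>M count_space UNIV" for m
    unfolding k_def by measurable
  define H where "H = (\<lambda>m z. ennreal (norm (T (g (k m (snd z))) (fst z))))"
  have [measurable]: "T (g j) \<in> borel_measurable borel" for j
    using admissible_continuous[OF T(1) gLI] by (rule borel_measurable_continuous_onI)
  have H[measurable]: "H m \<in> borel_measurable (lborel \<Otimes>\<^sub>M M)" for m
    unfolding H_def
    by (rule measurable_compose_countable[where f="\<lambda>j z. ennreal (norm (T (g j) (fst z)))" and g="\<lambda>z. k m (snd z)"])
       measurable
  define Q where "Q = (\<lambda>n x. (\<integral>\<^sup>+t. indicator {-1 / real (Suc n)..1 / real (Suc n)} t *
      limsup (\<lambda>m. H m (t, x)) \<partial>lborel) * ennreal (real (Suc n) / 2))"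
  have Q: "Q n \<in> borel_measurable M" for n
    unfolding Q_def by measurable
  have "AE x in M. limsup (\<lambda>n. Q n x) = ennreal (norm (transferred U T f x))"
    using Feq Veq Vfin orbit_locally_integrable[OF f] AE_space
  proof eventually_elim
    case (elim x)
    let ?f = "\<lambda>t. f (U t x)"
    have Fx[measurable]: "(\<lambda>t. F (t, x)) \<in> borel_measurable borel"
      using measurable_compose[OF measurable_Pair2'[OF elim(5)] F] by simp
    have "(\<integral>\<^sup>+t. ?i t * ennreal (norm (F (t, x)) powr p) \<partial>lborel) = (\<integral>\<^sup>+t. ?i t * V (t, x) \<partial>lborel)"
      by (rule nn_integral_cong_AE) (use elim(1,2) in \<open>eventually_elim, auto\<close>)
    with elim(3) have Ffin: "(\<integral>\<^sup>+t. ?i t * ennreal (norm (F (t, x)) powr p) \<partial>lborel) < \<infinity>"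
      by (simp add: top.not_eq_extremum)
    have close: "(\<integral>\<^sup>+t. ?i t * ennreal (norm (F (t, x) - g (k m x) t) powr p) \<partial>lborel) < ennreal ((1 / 2) ^ m)" for m
      unfolding k_def by (rule LeastI_ex) (rule dense[OF Fx _ Ffin], simp)
    have "(\<integral>\<^sup>+t. ?i t * ennreal (norm (?f t - g (k m x) t) powr p) \<partial>lebesgue) < ennreal ((1 / 2) ^ m)" for m
    proof -
      have "(\<integral>\<^sup>+t. ?i t * ennreal (norm (?f t - g (k m x) t) powr p) \<partial>lebesgue)
          = (\<integral>\<^sup>+t. ?i t * ennreal (norm (F (t, x) - g (k m x) t) powr p) \<partial>lborel)"
        unfolding nn_integral_completion
        by (rule nn_integral_cong_AE) (use elim(1) in \<open>eventually_elim, auto\<close>)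
      with close show ?thesis by simp
    qed
    from weak_type_AE_convergence[OF T semilocal elim(4) gLI this]
    have conv: "AE t in lborel. \<bar>t\<bar> \<le> 1 \<longrightarrow> (\<lambda>m. norm (T (g (k m x)) t)) \<longlonglongrightarrow> norm (T ?f t)"
      by (simp add: AE_completion_iff)
    have "AE t in lborel. \<bar>t\<bar> \<le> 1 \<longrightarrow> limsup (\<lambda>m. H m (t, x)) = ennreal (norm (T ?f t))"
      using conv
    proof eventually_elim
      case (elim t)
      show ?case
      proof
        assume "\<bar>t\<bar> \<le> 1"
        with elim have "(\<lambda>m. H m (t, x)) \<longlonglongrightarrow> ennreal (norm (T ?f t))"
          unfolding H_def by (auto intro: tendsto_ennrealI)
        then show "limsup (\<lambda>m. H m (t, x)) = ennreal (norm (T ?f t))"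
          by (rule lim_imp_Limsup[OF sequentially_bot])
      qed
    qed
    then have "(\<lambda>n. Q n x) \<longlonglongrightarrow> ennreal (norm (T ?f 0))"
      unfolding Q_def
      by (intro averages_tendsto continuous_on_norm admissible_continuous[OF T(1) elim(4)]) auto
    then show ?case
      unfolding transferred_def by (rule lim_imp_Limsup[OF sequentially_bot])
  qed
  moreover have "(\<lambda>x. limsup (\<lambda>n. Q n x)) \<in> borel_measurable (completion M)"
    using Q by (intro measurable_completion) measurable
  ultimately show ?thesis
    by (rule measurable_completion_AE[rotated])
qed

end

section \<open>Transfer of inequalities from the line to the flow\<close>

text \<open>With finitely many operators a single \<open>\<epsilon>\<close> serves in the support condition of all of them, which may fail
  for the whole sequence.\<close>

definition partial_maximal ::
  "(nat \<Rightarrow> ('b \<Rightarrow> 'k) \<Rightarrow> 'b \<Rightarrow> 'k::real_normed_vector) \<Rightarrow> nat \<Rightarrow> ('b \<Rightarrow> 'k) \<Rightarrow> 'b \<Rightarrow> ennreal" where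
  "partial_maximal T N f x = (SUP n\<in>{..N}. ennreal (norm (T n f x)))"

lemma incseq_partial_maximal: "incseq (\<lambda>N. partial_maximal T N f x)"
  unfolding partial_maximal_def by (intro incseq_SucI SUP_subset_mono) auto

lemma maximal_eq_SUP_partial: "maximal T f x = (SUP N. partial_maximal T N f x)"
  unfolding maximal_def partial_maximal_def
proof (rule antisym)
  show "(SUP n. ennreal (norm (T n f x))) \<le> (SUP N. SUP n\<in>{..N}. ennreal (norm (T n f x)))"
    by (rule SUP_mono) (auto intro: SUP_upper)
  show "(SUP N. SUP n\<in>{..N}. ennreal (norm (T n f x))) \<le> (SUP n. ennreal (norm (T n f x)))"
    by (intro SUP_least SUP_upper) auto
qed

lemma partial_le_maximal: "partial_maximal T N f x \<le> maximal T f x"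
  unfolding maximal_eq_SUP_partial by (rule SUP_upper) simp

lemma borel_measurable_maximal:
  assumes "\<And>n. (\<lambda>x. ennreal (norm (T n f x))) \<in> borel_measurable M"
  shows "maximal T f \<in> borel_measurable M"
    and "partial_maximal T N f \<in> borel_measurable M"
  using assms unfolding maximal_def[abs_def] partial_maximal_def[abs_def] by measurable

lemma borel_measurable_maximal_line:
  assumes "\<And>n. admissible (T n)" "locally_integrable f"
  shows "maximal T f \<in> borel_measurable lebesgue"
proof (rule borel_measurable_maximal)
  fix n
  have "continuous_on UNIV (T n f)" using assms by (rule admissible_continuous)
  then have "T n f \<in> borel_measurable borel" by (rule borel_measurable_continuous_onI)
  then have "(\<lambda>x. ennreal (norm (T n f x))) \<in> borel_measurable lborel" by simp
  then show "(\<lambda>x. ennreal (norm (T n f x))) \<in> borel_measurable lebesgue"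
    by (rule measurable_completion)
qed

text \<open>Lets \<open>A \<rightarrow> \<infinity>\<close>, where the ratio \<open>(A + \<epsilon>) / A\<close> of the lengths of the two time intervals tends to \<open>1\<close>. This is
  why the constant on the flow is the same as the constant on the line.\<close>

lemma ennreal_le_by_ratio:
  fixes P K :: ennreal and \<epsilon> :: real
  assumes "0 < \<epsilon>" "K < \<infinity>" and le: "\<And>A. 0 < A \<Longrightarrow> ennreal A * P \<le> ennreal (A + \<epsilon>) * K"
  shows "P \<le> K"
proof -
  obtain k where k: "K = ennreal k" "0 \<le> k" using assms(2) by (cases K) auto
  have "P \<noteq> \<infinity>"
    using le[of 1] k assms(1) by (auto simp: top_unique ennreal_mult_eq_top_iff)
  then obtain q where q: "P = ennreal q" "0 \<le> q" by (cases P) auto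
  have real_le: "A * q \<le> (A + \<epsilon>) * k" if "0 < A" for A
    using le[OF that] that assms(1) k q by (simp add: ennreal_mult[symmetric] del: ennreal_plus)
  have "q \<le> k"
  proof (rule ccontr)
    assume "\<not> q \<le> k"
    then have d: "0 < q - k" by simp
    define A where "A = \<epsilon> * k / (q - k) + 1"
    have "0 < A" using d assms(1) k by (simp add: A_def add_nonneg_pos)
    from real_le[OF this] have "A * (q - k) \<le> \<epsilon> * k" by (simp add: algebra_simps)
    moreover have "A * (q - k) = \<epsilon> * k + (q - k)" using d by (simp add: A_def field_simps)
    ultimately show False using d by simp
  qed
  then show ?thesis using k q by (simp add: ennreal_leI)
qed

context measurable_flow
begin

text \<open>By the group law the orbit function of \<open>U t x\<close> is a translate of the orbit function of \<open>x\<close>, and \<open>T\<close>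
  commutes with translations.\<close>

lemma transferred_along_orbit:
  assumes "admissible T" "x \<in> space M" "locally_integrable (\<lambda>s. f (U s x))"
  shows "transferred U T f (U t x) = T (\<lambda>s. f (U s x)) t"
proof -
  have "transferred U T f (U t x) = T (\<lambda>s. f (U (s + t) x)) 0"
    unfolding transferred_def using flow_add[OF assms(2)] by simp
  also have "\<dots> = T (\<lambda>s. f (U s x)) (0 + t)"
    by (rule admissible_shift[OF assms(1,3)])
  finally show ?thesis by simp
qed

text \<open>The strong and the weak inequality are the two cases \<open>\<psi> u = u\<^sup>p\<close> and \<open>\<psi> = 1\<^bsub>(l, \<infinity>)\<^esub>\<close> of one statement.
  Apart from measurability, the transfer needs of \<open>\<psi>\<close> monotonicity, to compare maximal functions, and
  continuity from below, to pass from finitely many operators to all of them.\<close>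

context
  fixes T :: "nat \<Rightarrow> (real \<Rightarrow> 'k::{real_normed_field, euclidean_space}) \<Rightarrow> real \<Rightarrow> 'k"
    and r :: ennreal and p :: real and \<psi> :: "ennreal \<Rightarrow> ennreal" and D :: real
    and f :: "nat \<Rightarrow> 'a \<Rightarrow> 'k"
  assumes T: "\<And>n. admissible (T n)" and r: "1 \<le> r" and p: "1 \<le> p"
    and \<psi>_measurable: "\<psi> \<in> borel_measurable borel"
    and \<psi>_mono: "\<And>u v. u \<le> v \<Longrightarrow> \<psi> u \<le> \<psi> v"
    and \<psi>_SUP: "\<And>u :: nat \<Rightarrow> ennreal. incseq u \<Longrightarrow> \<psi> (SUP N. u N) = (SUP N. \<psi> (u N))"
    and line: "\<And>f :: nat \<Rightarrow> real \<Rightarrow> 'k. \<forall>j. locally_integrable (f j) \<Longrightarrow>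
      (\<integral>\<^sup>+t. \<psi> (lr_norm r (\<lambda>j. maximal T (f j) t)) \<partial>lebesgue)
      \<le> ennreal D * (\<integral>\<^sup>+t. epow (lr_norm r (\<lambda>j. ennreal (norm (f j t)))) p \<partial>lebesgue)"
    and f: "\<And>j. bounded_plus_integrable M (f j)"
    and finite_norm: "(\<integral>\<^sup>+x. epow (lr_norm r (\<lambda>j. ennreal (norm (f j x)))) p \<partial>M) < \<infinity>"
    and meas: "\<And>n j. (\<lambda>x. ennreal (norm (transferred U (T n) (f j) x))) \<in> borel_measurable (completion M)"
begin

text \<open>Cutting \<open>F\<close> off outside \<open>[-(A + \<epsilon>), A + \<epsilon>]\<close> changes nothing on \<open>[-A, A]\<close>, so the inequality on the line
  becomes one between integrals over bounded intervals, which are the ones that can be integrated over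
  the space of orbits.\<close>

lemma line_inequality_on_interval:
  fixes F :: "nat \<Rightarrow> real \<Rightarrow> 'k"
  assumes F: "\<And>j. locally_integrable (F j)"
    and semilocal: "\<And>n. n \<le> N \<Longrightarrow> semilocal (T n) \<epsilon>"
  shows "(\<integral>\<^sup>+t. indicator {-A..A} t * \<psi> (lr_norm r (\<lambda>j. partial_maximal T N (F j) t)) \<partial>lebesgue)
    \<le> ennreal D * (\<integral>\<^sup>+t. indicator {-(A + \<epsilon>)..A + \<epsilon>} t
         * epow (lr_norm r (\<lambda>j. ennreal (norm (F j t)))) p \<partial>lebesgue)"
proof -
  define h where "h = (\<lambda>j t. indicator {-(A + \<epsilon>)..A + \<epsilon>} t *\<^sub>R F j t)"
  have h: "locally_integrable (h j)" for j
    unfolding h_def by (intro locally_integrable_restrict F) auto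
  have "(\<integral>\<^sup>+t. indicator {-A..A} t * \<psi> (lr_norm r (\<lambda>j. partial_maximal T N (F j) t)) \<partial>lebesgue)
      \<le> (\<integral>\<^sup>+t. \<psi> (lr_norm r (\<lambda>j. maximal T (h j) t)) \<partial>lebesgue)"
  proof (rule nn_integral_mono)
    fix t
    show "indicator {-A..A} t * \<psi> (lr_norm r (\<lambda>j. partial_maximal T N (F j) t))
        \<le> \<psi> (lr_norm r (\<lambda>j. maximal T (h j) t))"
    proof (cases "t \<in> {-A..A}")
      case True
      have "norm (T n (F j) t) = norm (T n (h j) t)" if "n \<le> N" for n j
      proof (rule semilocalD[OF semilocal[OF that] F h])
        show "AE s in lebesgue. s \<in> {-(A + \<epsilon>)<..<A + \<epsilon>} \<longrightarrow> F j s = h j s"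
          by (auto simp: h_def)
      qed (use True in auto)
      then have "partial_maximal T N (F j) t = partial_maximal T N (h j) t" for j
        unfolding partial_maximal_def by (intro SUP_cong) auto
      then have "\<psi> (lr_norm r (\<lambda>j. partial_maximal T N (F j) t)) \<le> \<psi> (lr_norm r (\<lambda>j. maximal T (h j) t))"
        by (auto intro!: \<psi>_mono lr_norm_mono[OF r] partial_le_maximal)
      then show ?thesis using True by simp
    next
      case False
      then show ?thesis by (simp only: indicator_simps(2)[OF False] mult_zero_left zero_le)
    qed
  qed
  also have "\<dots> \<le> ennreal D * (\<integral>\<^sup>+t. epow (lr_norm r (\<lambda>j. ennreal (norm (h j t)))) p \<partial>lebesgue)"
    using h by (intro line) auto
  also have "(\<integral>\<^sup>+t. epow (lr_norm r (\<lambda>j. ennreal (norm (h j t)))) p \<partial>lebesgue)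
      = (\<integral>\<^sup>+t. indicator {-(A + \<epsilon>)..A + \<epsilon>} t * epow (lr_norm r (\<lambda>j. ennreal (norm (F j t)))) p \<partial>lebesgue)"
    using p by (intro nn_integral_cong) (auto simp: h_def indicator_def lr_norm_zero[OF r])
  finally show ?thesis .
qed

text \<open>Calderon's argument. Apply the interval inequality to the orbit functions of almost every \<open>x\<close> and integrate
  over \<open>x\<close>. By the invariance of the measure the two sides are the lengths of the time intervals times
  integrals over the space; divide by the length and let it tend to infinity.\<close>

lemma partial_transferred_inequality:
  "(\<integral>\<^sup>+x. \<psi> (lr_norm r (\<lambda>j. partial_maximal (\<lambda>n. transferred U (T n)) N (f j) x)) \<partial>completion M)
    \<le> ennreal D * (\<integral>\<^sup>+x. epow (lr_norm r (\<lambda>j. ennreal (norm (f j x)))) p \<partial>M)"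
proof -
  obtain e where e: "\<And>n. 0 < e n" "\<And>n. semilocal (T n) (e n)"
    using admissible_semilocal[OF T] by metis
  define \<epsilon> where "\<epsilon> = Max (e ` {..N})"
  have e_le: "e n \<le> \<epsilon>" if "n \<le> N" for n unfolding \<epsilon>_def using that by (intro Max_ge) auto
  then have \<epsilon>: "0 < \<epsilon>" using e(1)[of 0] by (meson le0 order_less_le_trans)
  have semilocal: "semilocal (T n) \<epsilon>" if "n \<le> N" for n
    using semilocal_mono[OF e(2) e_le[OF that]] .
  define w where "w = (\<lambda>x. \<psi> (lr_norm r (\<lambda>j. partial_maximal (\<lambda>n. transferred U (T n)) N (f j) x)))"
  define \<phi> where "\<phi> = (\<lambda>x. epow (lr_norm r (\<lambda>j. ennreal (norm (f j x)))) p)"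
  have [measurable]: "f j \<in> borel_measurable M" for j
    using f[of j] by (auto simp: bounded_plus_integrable_def cong: measurable_cong)
  have \<phi>: "\<phi> \<in> borel_measurable M"
    unfolding \<phi>_def by measurable
  have "w \<in> borel_measurable (completion M)"
    unfolding w_def
    by (rule measurable_compose[OF _ \<psi>_measurable], rule borel_measurable_lr_norm,
        rule borel_measurable_maximal(2), rule meas)
  then obtain W where W: "W \<in> borel_measurable M" and wW: "AE x in M. w x = W x"
    using completion_ex_borel_measurable by blast
  obtain V where V[measurable]: "V \<in> borel_measurable (lborel \<Otimes>\<^sub>M M)"
    and WV: "AE x in M. AE t in lborel. W (U t x) = V (t, x)"
    and intV: "\<And>B. B \<in> sets borel \<Longrightarrow> (\<integral>\<^sup>+x. \<integral>\<^sup>+t. indicator B t * V (t, x) \<partial>lborel \<partial>M)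
        = emeasure lborel B * (\<integral>\<^sup>+x. W x \<partial>M)"
    by (rule orbit_integral[OF W], rule that) blast+
  obtain V' where V'[measurable]: "V' \<in> borel_measurable (lborel \<Otimes>\<^sub>M M)"
    and \<phi>V': "AE x in M. AE t in lborel. \<phi> (U t x) = V' (t, x)"
    and intV': "\<And>B. B \<in> sets borel \<Longrightarrow> (\<integral>\<^sup>+x. \<integral>\<^sup>+t. indicator B t * V' (t, x) \<partial>lborel \<partial>M)
        = emeasure lborel B * (\<integral>\<^sup>+x. \<phi> x \<partial>M)"
    by (rule orbit_integral[OF \<phi>], rule that) blast+
  have orbitwise: "AE x in M. (\<integral>\<^sup>+t. indicator {-A..A} t * V (t, x) \<partial>lborel)
      \<le> ennreal D * (\<integral>\<^sup>+t. indicator {-(A + \<epsilon>)..A + \<epsilon>} t * V' (t, x) \<partial>lborel)" for A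
  proof -
    have "AE x in M. \<forall>j. locally_integrable (\<lambda>t. f j (U t x))"
      unfolding AE_all_countable by (intro allI orbit_locally_integrable f)
    with AE_orbit[OF wW] WV \<phi>V' AE_space show ?thesis
    proof eventually_elim
      case (elim x)
      have w: "w (U t x) = \<psi> (lr_norm r (\<lambda>j. partial_maximal T N (\<lambda>s. f j (U s x)) t))" for t
        using elim(4,5) by (simp add: w_def partial_maximal_def transferred_along_orbit T)
      have "(\<integral>\<^sup>+t. indicator {-A..A} t * V (t, x) \<partial>lborel)
          = (\<integral>\<^sup>+t. indicator {-A..A} t * w (U t x) \<partial>lborel)"
        by (rule nn_integral_cong_AE) (use elim(1,2) in \<open>eventually_elim, auto\<close>)
      also have "\<dots> = (\<integral>\<^sup>+t. indicator {-A..A} t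
          * \<psi> (lr_norm r (\<lambda>j. partial_maximal T N (\<lambda>s. f j (U s x)) t)) \<partial>lebesgue)"
        by (simp add: nn_integral_completion w)
      also have "\<dots> \<le> ennreal D * (\<integral>\<^sup>+t. indicator {-(A + \<epsilon>)..A + \<epsilon>} t
          * epow (lr_norm r (\<lambda>j. ennreal (norm (f j (U t x))))) p \<partial>lebesgue)"
        using elim(5) by (intro line_inequality_on_interval semilocal) auto
      also have "(\<integral>\<^sup>+t. indicator {-(A + \<epsilon>)..A + \<epsilon>} t
          * epow (lr_norm r (\<lambda>j. ennreal (norm (f j (U t x))))) p \<partial>lebesgue)
          = (\<integral>\<^sup>+t. indicator {-(A + \<epsilon>)..A + \<epsilon>} t * V' (t, x) \<partial>lborel)"
        unfolding nn_integral_completion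
        by (rule nn_integral_cong_AE) (use elim(3) in \<open>eventually_elim, auto simp: \<phi>_def\<close>)
      finally show ?case .
    qed
  qed
  have "(\<integral>\<^sup>+x. W x \<partial>M) \<le> ennreal D * (\<integral>\<^sup>+x. \<phi> x \<partial>M)"
  proof (rule ennreal_le_by_ratio)
    show "0 < 2 * \<epsilon>" using \<epsilon> by simp
    show "ennreal D * (\<integral>\<^sup>+x. \<phi> x \<partial>M) < \<infinity>"
      using finite_norm by (simp add: \<phi>_def ennreal_mult_less_top)
    fix A :: real assume A: "0 < A"
    \<comment> \<open>Half-lengths that make the measures \<open>A\<close> and \<open>A + 2 \<epsilon>\<close>, as the ratio argument requires.\<close>
    let ?I = "{-(A / 2)..A / 2}" and ?J = "{-(A / 2 + \<epsilon>)..A / 2 + \<epsilon>}"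
    have "ennreal A * (\<integral>\<^sup>+x. W x \<partial>M) = (\<integral>\<^sup>+x. \<integral>\<^sup>+t. indicator ?I t * V (t, x) \<partial>lborel \<partial>M)"
      using intV[of ?I] A by simp
    also have "\<dots> \<le> (\<integral>\<^sup>+x. ennreal D * (\<integral>\<^sup>+t. indicator ?J t * V' (t, x) \<partial>lborel) \<partial>M)"
      by (rule nn_integral_mono_AE[OF orbitwise])
    also have "\<dots> = ennreal D * (\<integral>\<^sup>+x. \<integral>\<^sup>+t. indicator ?J t * V' (t, x) \<partial>lborel \<partial>M)"
      by (rule nn_integral_cmult) measurable
    also have "\<dots> = ennreal D * (emeasure lborel ?J * (\<integral>\<^sup>+x. \<phi> x \<partial>M))"
      by (subst intV') auto
    also have "emeasure lborel ?J = ennreal (A + 2 * \<epsilon>)"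
      using A \<epsilon> by (subst emeasure_lborel_Icc) (auto simp: algebra_simps)
    finally show "ennreal A * (\<integral>\<^sup>+x. W x \<partial>M)
        \<le> ennreal (A + 2 * \<epsilon>) * (ennreal D * (\<integral>\<^sup>+x. \<phi> x \<partial>M))"
      by (simp add: mult_ac)
  qed
  also have "(\<integral>\<^sup>+x. W x \<partial>M) = (\<integral>\<^sup>+x. w x \<partial>M)"
    by (rule nn_integral_cong_AE) (use wW in \<open>eventually_elim, auto\<close>)
  finally show ?thesis by (simp add: nn_integral_completion w_def \<phi>_def)
qed

theorem transferred_inequality:
  "(\<integral>\<^sup>+x. \<psi> (lr_norm r (\<lambda>j. maximal (\<lambda>n. transferred U (T n)) (f j) x)) \<partial>completion M)
    \<le> ennreal D * (\<integral>\<^sup>+x. epow (lr_norm r (\<lambda>j. ennreal (norm (f j x)))) p \<partial>M)"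
proof -
  let ?h = "\<lambda>N x. lr_norm r (\<lambda>j. partial_maximal (\<lambda>n. transferred U (T n)) N (f j) x)"
  have inc: "incseq (\<lambda>N. ?h N x)" for x
    by (auto simp: incseq_def intro!: lr_norm_mono[OF r] incseqD[OF incseq_partial_maximal])
  have "(\<integral>\<^sup>+x. \<psi> (lr_norm r (\<lambda>j. maximal (\<lambda>n. transferred U (T n)) (f j) x)) \<partial>completion M)
      = (\<integral>\<^sup>+x. (SUP N. \<psi> (?h N x)) \<partial>completion M)"
    unfolding maximal_eq_SUP_partial
    by (subst lr_norm_SUP[OF r incseq_partial_maximal], subst \<psi>_SUP[OF inc]) (rule refl)
  also have "\<dots> = (SUP N. \<integral>\<^sup>+x. \<psi> (?h N x) \<partial>completion M)"
  proof (rule nn_integral_monotone_convergence_SUP)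
    show "incseq (\<lambda>N x. \<psi> (?h N x))"
      using inc by (auto simp: incseq_def le_fun_def intro!: \<psi>_mono)
    show "(\<lambda>x. \<psi> (?h N x)) \<in> borel_measurable (completion M)" for N
      by (rule measurable_compose[OF _ \<psi>_measurable], rule borel_measurable_lr_norm,
          rule borel_measurable_maximal(2), rule meas)
  qed
  also have "\<dots> \<le> ennreal D * (\<integral>\<^sup>+x. epow (lr_norm r (\<lambda>j. ennreal (norm (f j x)))) p \<partial>M)"
    by (intro SUP_least partial_transferred_inequality)
  finally show ?thesis .
qed

end

text \<open>If the sequence norm has a finite \<open>p\<close>-th moment, so does each entry, and the result for a single
  operator and a single function applies to all pairs of them.\<close>

lemma maximal_transferred_measurable:
  fixes f :: "nat \<Rightarrow> 'a \<Rightarrow> 'k::{real_normed_field, euclidean_space}"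
  assumes T: "\<And>n. admissible (T n)" "\<And>n. weak_type (T n) p c" and r: "1 \<le> r" and p: "1 \<le> p"
    and f: "\<And>j. bounded_plus_integrable M (f j)"
    and fin: "(\<integral>\<^sup>+x. epow (lr_norm r (\<lambda>j. ennreal (norm (f j x)))) p \<partial>M) < \<infinity>"
  shows "(\<lambda>x. ennreal (norm (transferred U (T n) (f j) x))) \<in> borel_measurable (completion M)"
    and "(\<lambda>x. lr_norm r (\<lambda>j. maximal (\<lambda>n. transferred U (T n)) (f j) x)) \<in> borel_measurable (completion M)"
proof -
  have single: "(\<lambda>x. ennreal (norm (transferred U (T n) (f j) x))) \<in> borel_measurable (completion M)" for n j
  proof (rule transferred_measurable[OF T p f])
    have "(\<integral>\<^sup>+x. ennreal (norm (f j x) powr p) \<partial>M)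
        \<le> (\<integral>\<^sup>+x. epow (lr_norm r (\<lambda>j. ennreal (norm (f j x)))) p \<partial>M)"
    proof (rule nn_integral_mono)
      fix x
      have "epow (ennreal (norm (f j x))) p \<le> epow (lr_norm r (\<lambda>j. ennreal (norm (f j x)))) p"
        using p by (intro epow_mono component_le_lr_norm[OF r, of "\<lambda>j. ennreal (norm (f j x))"]) auto
      then show "ennreal (norm (f j x) powr p) \<le> epow (lr_norm r (\<lambda>j. ennreal (norm (f j x)))) p"
        by (simp add: epow_ennreal)
    qed
    with fin show "(\<integral>\<^sup>+x. ennreal (norm (f j x) powr p) \<partial>M) < \<infinity>" by simp
  qed
  show "(\<lambda>x. ennreal (norm (transferred U (T n) (f j) x))) \<in> borel_measurable (completion M)"
    by (rule single)
  show "(\<lambda>x. lr_norm r (\<lambda>j. maximal (\<lambda>n. transferred U (T n)) (f j) x)) \<in> borel_measurable (completion M)"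
    by (intro borel_measurable_lr_norm borel_measurable_maximal(1) single)
qed

end

text \<open>Test the inequality on sequences with one nonzero entry, whose sequence norm is the modulus of that entry.\<close>

lemma weak_type_if_vector_weak_type:
  fixes T :: "nat \<Rightarrow> (real \<Rightarrow> 'k::{real_normed_field, euclidean_space}) \<Rightarrow> real \<Rightarrow> 'k"
  assumes T: "\<And>n. admissible (T n)" and r: "1 \<le> r"
    and line: "\<And>l f. 0 < l \<Longrightarrow> \<forall>j. locally_integrable (f j) \<Longrightarrow>
           emeasure lebesgue {t. lr_norm r (\<lambda>j. maximal T (f j) t) > ennreal l}
           \<le> ennreal (c powr p / l powr p)
               * (\<integral>\<^sup>+ t. epow (lr_norm r (\<lambda>j. ennreal (norm (f j t)))) p \<partial>lebesgue)"
  shows "weak_type (T n) p c"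
  unfolding weak_type_def
proof (intro allI impI)
  fix g :: "real \<Rightarrow> 'k" and l :: real
  assume g: "locally_integrable g" and l: "0 < l"
  define F where "F = (\<lambda>j::nat. if j = 0 then g else (\<lambda>t. 0))"
  have F: "\<forall>j. locally_integrable (F j)" using g by (simp add: F_def)
  have m: "(\<lambda>t. lr_norm r (\<lambda>j. maximal T (F j) t)) \<in> borel_measurable lebesgue"
    using F by (intro borel_measurable_lr_norm borel_measurable_maximal_line T) auto
  have "emeasure lebesgue {t. l < norm (T n g t)}
      \<le> emeasure lebesgue {t. lr_norm r (\<lambda>j. maximal T (F j) t) > ennreal l}"
  proof (rule emeasure_mono)
    show "{t. l < norm (T n g t)} \<subseteq> {t. lr_norm r (\<lambda>j. maximal T (F j) t) > ennreal l}"
    proof safe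
      fix t assume "l < norm (T n g t)"
      then have "ennreal l < ennreal (norm (T n (F 0) t))"
        using l by (simp add: F_def ennreal_less_iff)
      also have "\<dots> \<le> maximal T (F 0) t" unfolding maximal_def by (rule SUP_upper) simp
      also have "\<dots> \<le> lr_norm r (\<lambda>j. maximal T (F j) t)"
        by (rule component_le_lr_norm[OF r, of "\<lambda>j. maximal T (F j) t"])
      finally show "lr_norm r (\<lambda>j. maximal T (F j) t) > ennreal l" .
    qed
    show "{t. lr_norm r (\<lambda>j. maximal T (F j) t) > ennreal l} \<in> sets lebesgue"
      using borel_measurable_less[OF borel_measurable_const m] by simp
  qed
  also have "\<dots> \<le> ennreal (c powr p / l powr p)
               * (\<integral>\<^sup>+ t. epow (lr_norm r (\<lambda>j. ennreal (norm (F j t)))) p \<partial>lebesgue)"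
    by (rule line[OF l F])
  also have "(\<lambda>j. ennreal (norm (F j t))) = (\<lambda>j. if j = 0 then ennreal (norm (g t)) else 0)" for t
    by (auto simp: F_def)
  then have "(\<integral>\<^sup>+ t. epow (lr_norm r (\<lambda>j. ennreal (norm (F j t)))) p \<partial>lebesgue)
      = (\<integral>\<^sup>+t. ennreal (norm (g t) powr p) \<partial>lebesgue)"
    by (simp add: lr_norm_single[OF r] epow_ennreal)
  finally show "emeasure lebesgue {t. l < norm (T n g t)}
     \<le> ennreal (c powr p / l powr p) * (\<integral>\<^sup>+t. ennreal (norm (g t) powr p) \<partial>lebesgue)" .
qed

text \<open>Chebyshev's inequality in the form needed here: the strong inequality on the line implies the weak one, so
  that measurability of the transferred operators has to be proved from the weak one only.\<close>

lemma weak_bound_if_strong_bound: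
  assumes h: "h \<in> borel_measurable M" and l: "0 < l" and p: "0 < p"
    and strong: "(\<integral>\<^sup>+x. epow (h x) p \<partial>M) \<le> ennreal (c powr p) * R"
  shows "emeasure M {x \<in> space M. h x > ennreal l} \<le> ennreal (c powr p / l powr p) * R"
proof -
  let ?E = "{x \<in> space M. h x > ennreal l}"
  have [measurable]: "?E \<in> sets M" using h by measurable
  have "ennreal (l powr p) * emeasure M ?E = (\<integral>\<^sup>+x. ennreal (l powr p) * indicator ?E x \<partial>M)"
    by (simp add: nn_integral_cmult_indicator)
  also have "\<dots> \<le> (\<integral>\<^sup>+x. epow (h x) p \<partial>M)"
  proof (rule nn_integral_mono)
    fix x
    have "ennreal (l powr p) \<le> epow (h x) p" if "ennreal l < h x"
      using epow_mono[OF p less_imp_le[OF that]] l by (simp add: epow_ennreal)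
    then show "ennreal (l powr p) * indicator ?E x \<le> epow (h x) p"
      by (auto simp: indicator_def)
  qed
  also note strong
  finally have "ennreal (1 / l powr p) * (ennreal (l powr p) * emeasure M ?E)
      \<le> ennreal (1 / l powr p) * (ennreal (c powr p) * R)"
    by (intro mult_left_mono) auto
  moreover have "ennreal (1 / l powr p) * ennreal (l powr p) = 1"
    using l by (subst ennreal_mult[symmetric]) auto
  moreover have "ennreal (1 / l powr p) * ennreal (c powr p) = ennreal (c powr p / l powr p)"
    by (subst ennreal_mult[symmetric]) auto
  ultimately show ?thesis by (simp add: mult.assoc[symmetric])
qed

(* The transferred functions are defined almost everywhere only, hence the completion of M on the
   left-hand sides of the conclusions. Since the integral and the measure are total functions,
   the measurability that gives these left-hand sides their meaning is part of the conclusions;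
   if the integral on the right-hand side is infinite, the inequalities hold trivially. *)
theorem theorem1:
  fixes M :: "'a measure"
    and U :: "real \<Rightarrow> 'a \<Rightarrow> 'a"
    and T :: "nat \<Rightarrow> (real \<Rightarrow> 'k::{real_normed_field, euclidean_space}) \<Rightarrow> real \<Rightarrow> 'k"
    and r :: ennreal and p :: real
  assumes "sigma_finite_measure M"
    and "measure_preserving_flow M U"
    and "\<And>f :: 'a \<Rightarrow> 'k. f \<in> borel_measurable M \<Longrightarrow>
           (\<lambda>(t, x). f (U t x)) \<in> borel_measurable (completion (lborel \<Otimes>\<^sub>M M))"
    and "\<And>n. admissible (T n)"
    and "1 \<le> r" and "1 \<le> p"
  shows
    "(\<forall>C1>0.
        (\<forall>f :: nat \<Rightarrow> real \<Rightarrow> 'k. (\<forall>j. locally_integrable (f j)) \<longrightarrow>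
           epow (\<integral>\<^sup>+ t. epow (lr_norm r (\<lambda>j. maximal T (f j) t)) p \<partial>lebesgue) (1 / p)
           \<le> ennreal C1 * epow (\<integral>\<^sup>+ t. epow (lr_norm r (\<lambda>j. ennreal (norm (f j t)))) p \<partial>lebesgue) (1 / p))
        \<longrightarrow>
        (\<forall>f :: nat \<Rightarrow> 'a \<Rightarrow> 'k. (\<forall>j. bounded_plus_integrable M (f j)) \<longrightarrow>
           ((\<integral>\<^sup>+ x. epow (lr_norm r (\<lambda>j. ennreal (norm (f j x)))) p \<partial>M) < \<infinity> \<longrightarrow>
             (\<lambda>x. lr_norm r (\<lambda>j. maximal (\<lambda>n. transferred U (T n)) (f j) x))
               \<in> borel_measurable (completion M)) \<and>
           epow (\<integral>\<^sup>+ x. epow (lr_norm r (\<lambda>j. maximal (\<lambda>n. transferred U (T n)) (f j) x)) p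
                   \<partial>completion M) (1 / p)
           \<le> ennreal C1 * epow (\<integral>\<^sup>+ x. epow (lr_norm r (\<lambda>j. ennreal (norm (f j x)))) p \<partial>M) (1 / p)))
     \<and>
     (\<forall>C2>0.
        (\<forall>l>0. \<forall>f :: nat \<Rightarrow> real \<Rightarrow> 'k. (\<forall>j. locally_integrable (f j)) \<longrightarrow>
           emeasure lebesgue {t. lr_norm r (\<lambda>j. maximal T (f j) t) > ennreal l}
           \<le> ennreal (C2 powr p / l powr p)
               * (\<integral>\<^sup>+ t. epow (lr_norm r (\<lambda>j. ennreal (norm (f j t)))) p \<partial>lebesgue))
        \<longrightarrow>
        (\<forall>l>0. \<forall>f :: nat \<Rightarrow> 'a \<Rightarrow> 'k. (\<forall>j. bounded_plus_integrable M (f j)) \<longrightarrow>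
           ((\<integral>\<^sup>+ x. epow (lr_norm r (\<lambda>j. ennreal (norm (f j x)))) p \<partial>M) < \<infinity> \<longrightarrow>
             (\<lambda>x. lr_norm r (\<lambda>j. maximal (\<lambda>n. transferred U (T n)) (f j) x))
               \<in> borel_measurable (completion M)) \<and>
           emeasure (completion M)
             {x \<in> space M. lr_norm r (\<lambda>j. maximal (\<lambda>n. transferred U (T n)) (f j) x) > ennreal l}
           \<le> ennreal (C2 powr p / l powr p)
               * (\<integral>\<^sup>+ x. epow (lr_norm r (\<lambda>j. ennreal (norm (f j x)))) p \<partial>M)))"
proof -
  interpret sigma_finite_measure M by fact
  interpret measurable_flow M U
    using assms(2) measurable_flow_if_functions_measurable[OF assms(2,3)]
    by unfold_locales auto
  note T = assms(4) and r = assms(5)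
  have p: "0 < p" using assms(6) by simp
  let ?R = "\<lambda>f. \<integral>\<^sup>+ x. epow (lr_norm r (\<lambda>j. ennreal (norm (f j x :: 'k)))) p \<partial>M"
  let ?S = "\<lambda>f x. lr_norm r (\<lambda>j. maximal (\<lambda>n. transferred U (T n)) (f j) x)"
  have line_measurable: "(\<lambda>t. lr_norm r (\<lambda>j. maximal T (f j) t)) \<in> borel_measurable lebesgue"
    if "\<forall>j. locally_integrable (f j)" for f
    using that by (intro borel_measurable_lr_norm borel_measurable_maximal_line T) auto
  show ?thesis
  proof (intro conjI allI impI)
    fix C1 :: real and f :: "nat \<Rightarrow> 'a \<Rightarrow> 'k"
    assume C1: "0 < C1"
      and strong: "\<forall>f :: nat \<Rightarrow> real \<Rightarrow> 'k. (\<forall>j. locally_integrable (f j)) \<longrightarrow>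
           epow (\<integral>\<^sup>+ t. epow (lr_norm r (\<lambda>j. maximal T (f j) t)) p \<partial>lebesgue) (1 / p)
           \<le> ennreal C1 * epow (\<integral>\<^sup>+ t. epow (lr_norm r (\<lambda>j. ennreal (norm (f j t)))) p \<partial>lebesgue) (1 / p)"
      and f: "\<forall>j. bounded_plus_integrable M (f j)"
    have line: "(\<integral>\<^sup>+ t. epow (lr_norm r (\<lambda>j. maximal T (f j) t)) p \<partial>lebesgue)
        \<le> ennreal (C1 powr p) * (\<integral>\<^sup>+ t. epow (lr_norm r (\<lambda>j. ennreal (norm (f j t)))) p \<partial>lebesgue)"
      if "\<forall>j. locally_integrable (f j)" for f
      using epow_mono[OF p strong[rule_format, of f]] that p C1
      by (simp add: epow_epow epow_mult)
    have "weak_type (T n) p C1" for n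
    proof (rule weak_type_if_vector_weak_type[OF T r])
      fix l :: real and f :: "nat \<Rightarrow> real \<Rightarrow> 'k"
      assume "0 < l" "\<forall>j. locally_integrable (f j)"
      from weak_bound_if_strong_bound[OF line_measurable this(1) p line] this(2)
      show "emeasure lebesgue {t. lr_norm r (\<lambda>j. maximal T (f j) t) > ennreal l}
           \<le> ennreal (C1 powr p / l powr p)
               * (\<integral>\<^sup>+ t. epow (lr_norm r (\<lambda>j. ennreal (norm (f j t)))) p \<partial>lebesgue)"
        by simp
    qed
    note meas = maximal_transferred_measurable[OF T this r assms(6) f[rule_format]]
    show "?S f \<in> borel_measurable (completion M)" if "?R f < \<infinity>"
      by (rule meas(2)[OF that])
    show "epow (\<integral>\<^sup>+ x. epow (?S f x) p \<partial>completion M) (1 / p) \<le> ennreal C1 * epow (?R f) (1 / p)"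
    proof (cases "?R f < \<infinity>")
      case True
      have "(\<integral>\<^sup>+ x. epow (?S f x) p \<partial>completion M) \<le> ennreal (C1 powr p) * ?R f"
        by (rule transferred_inequality[where \<psi>="\<lambda>u. epow u p", OF T r assms(6)])
           (use p f True meas(1)[OF True] in \<open>auto intro: line epow_mono simp: epow_SUP\<close>)
      then have "epow (\<integral>\<^sup>+ x. epow (?S f x) p \<partial>completion M) (1 / p)
          \<le> epow (ennreal (C1 powr p) * ?R f) (1 / p)"
        using p by (intro epow_mono) auto
      also have "\<dots> = ennreal C1 * epow (?R f) (1 / p)"
        using p C1 by (simp add: epow_mult powr_powr)
      finally show ?thesis .
    next
      case False
      then have "?R f = \<infinity>" by (simp add: not_less top_unique)
      then show ?thesis using C1 by (simp add: ennreal_mult_top)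
    qed
  next
    fix C2 l :: real and f :: "nat \<Rightarrow> 'a \<Rightarrow> 'k"
    assume C2: "0 < C2" and l: "0 < l"
      and weak: "\<forall>l>0. \<forall>f :: nat \<Rightarrow> real \<Rightarrow> 'k. (\<forall>j. locally_integrable (f j)) \<longrightarrow>
           emeasure lebesgue {t. lr_norm r (\<lambda>j. maximal T (f j) t) > ennreal l}
           \<le> ennreal (C2 powr p / l powr p)
               * (\<integral>\<^sup>+ t. epow (lr_norm r (\<lambda>j. ennreal (norm (f j t)))) p \<partial>lebesgue)"
      and f: "\<forall>j. bounded_plus_integrable M (f j)"
    have "weak_type (T n) p C2" for n
      by (rule weak_type_if_vector_weak_type[OF T r weak[rule_format]]) auto
    note meas = maximal_transferred_measurable[OF T this r assms(6) f[rule_format]]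
    show "?S f \<in> borel_measurable (completion M)" if "?R f < \<infinity>"
      by (rule meas(2)[OF that])
    show "emeasure (completion M) {x \<in> space M. ?S f x > ennreal l}
        \<le> ennreal (C2 powr p / l powr p) * ?R f"
    proof (cases "?R f < \<infinity>")
      case True
      let ?\<psi> = "indicator {ennreal l<..} :: ennreal \<Rightarrow> ennreal"
      note S = meas(2)[OF True]
      have "{x \<in> space M. ?S f x > ennreal l} \<in> sets (completion M)"
        using borel_measurable_less[OF borel_measurable_const S] by simp
      then have "emeasure (completion M) {x \<in> space M. ?S f x > ennreal l}
          = (\<integral>\<^sup>+ x. indicator {x \<in> space M. ?S f x > ennreal l} x \<partial>completion M)"
        by simp
      also have "\<dots> = (\<integral>\<^sup>+ x. ?\<psi> (?S f x) \<partial>completion M)"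
        by (intro nn_integral_cong) (simp add: indicator_def)
      also have "\<dots> \<le> ennreal (C2 powr p / l powr p) * ?R f"
      proof (rule transferred_inequality[where \<psi>="?\<psi>", OF T r assms(6)])
        fix u v :: ennreal assume "u \<le> v"
        then show "?\<psi> u \<le> ?\<psi> v" by (auto simp: indicator_def)
      next
        fix u :: "nat \<Rightarrow> ennreal"
        show "?\<psi> (SUP N. u N) = (SUP N. ?\<psi> (u N))"
        proof (cases "\<exists>N. ennreal l < u N")
          case True
          then obtain N where N: "ennreal l < u N" ..
          have "?\<psi> (u N) \<le> (SUP N. ?\<psi> (u N))" by (rule SUP_upper) simp
          moreover have "(SUP N. ?\<psi> (u N)) \<le> 1" by (intro SUP_least) (simp add: indicator_def)
          moreover have "ennreal l < (SUP N. u N)" using N by (auto simp: less_SUP_iff)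
          ultimately show ?thesis using N by simp
        next
          case False
          then have "\<And>N. ?\<psi> (u N) = 0" by simp
          moreover have "\<not> ennreal l < (SUP N. u N)" using False by (simp add: less_SUP_iff)
          ultimately show ?thesis by simp
        qed
      next
        fix F :: "nat \<Rightarrow> real \<Rightarrow> 'k" assume F: "\<forall>j. locally_integrable (F j)"
        let ?E = "{t. lr_norm r (\<lambda>j. maximal T (F j) t) > ennreal l}"
        have "?E \<in> sets lebesgue"
          using borel_measurable_less[OF borel_measurable_const line_measurable[OF F]] by simp
        have "(\<integral>\<^sup>+ t. ?\<psi> (lr_norm r (\<lambda>j. maximal T (F j) t)) \<partial>lebesgue) = (\<integral>\<^sup>+ t. indicator ?E t \<partial>lebesgue)"
          by (intro nn_integral_cong) (simp add: indicator_def)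
        also have "\<dots> = emeasure lebesgue ?E"
          using \<open>?E \<in> sets lebesgue\<close> by (rule nn_integral_indicator)
        also have "\<dots> \<le> ennreal (C2 powr p / l powr p)
            * (\<integral>\<^sup>+ t. epow (lr_norm r (\<lambda>j. ennreal (norm (F j t)))) p \<partial>lebesgue)"
          using weak l F by blast
        finally show "(\<integral>\<^sup>+ t. ?\<psi> (lr_norm r (\<lambda>j. maximal T (F j) t)) \<partial>lebesgue)
            \<le> ennreal (C2 powr p / l powr p)
            * (\<integral>\<^sup>+ t. epow (lr_norm r (\<lambda>j. ennreal (norm (F j t)))) p \<partial>lebesgue)" .
      qed (use f True meas(1)[OF True] in auto)
      finally show ?thesis .
    next
      case False
      then have "?R f = \<infinity>" by (simp add: not_less top_unique)
      then show ?thesis using C2 l by (simp add: ennreal_mult_top)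
    qed
  qed
qed

end
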